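(* Let $G$ be a chordal graph with clique number $t\ge 2$. (a) For every odd integer $p\ge 1$ we have $\chi(G^{[\natural p]}) \le \binom{t}{2}\cdot (p+1)$. (b) For every even integer $p \ge 2$ we have $\chi(G^{[\natural p]}) \le \binom{t}{2}\cdot \Delta(G)\cdot (p+1)$.
   Context: All graphs are finite, simple, undirected and loopless. A graph is chordal if every cycle of length at least 4 has a chord (every induced cycle is a triangle). For a graph $G=(V,E)$ and a positive integer $p$, the exact distance-$p$ graph $G^{[\natural p]}$ has vertex set $V$, and $uv$ is an edge of $G^{[\natural p]}$ if and only if $d_G(u,v)=p$, where $d_G$ is the shortest-path distance in $G$. $\Delta(G)$ denotes the maximum degree of $G$ and $\chi$ the chromatic number. *)

theory Defs
  imports "Graph_Theory.Graph_Theory"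
begin

text \<open>
  A finite simple undirected graph is a \<^locale>\<open>pair_graph\<close>: a finite, loop-free, symmetric
  digraph whose arcs are pairs of vertices, so that each edge is represented by its two
  orientations.
\<close>

text \<open>
  Every vertex of a closed walk is the tail of one of its arcs. The closed walks
  \<open>[(x, y), (y, x)]\<close>, which count as cycles of a symmetric digraph, have length 2 and
  are irrelevant here.
\<close>

definition chord_of :: "'a pair_pre_digraph \<Rightarrow> ('a \<times> 'a) awalk \<Rightarrow> 'a \<Rightarrow> 'a \<Rightarrow> bool" where
  "chord_of G c x y \<longleftrightarrow>
     (x, y) \<in> parcs G \<and> x \<in> fst ` set c \<and> y \<in> fst ` set c \<and> (x, y) \<notin> set c \<and> (y, x) \<notin> set c"

definition chordal :: "'a pair_pre_digraph \<Rightarrow> bool" where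
  "chordal G \<longleftrightarrow>
     (\<forall>c. pre_digraph.cycle (with_proj G) c \<and> length c \<ge> 4 \<longrightarrow> (\<exists>x y. chord_of G c x y))"

definition is_clique :: "'a pair_pre_digraph \<Rightarrow> 'a set \<Rightarrow> bool" where
  "is_clique G K \<longleftrightarrow> K \<subseteq> pverts G \<and> (\<forall>x\<in>K. \<forall>y\<in>K. x \<noteq> y \<longrightarrow> (x, y) \<in> parcs G)"

definition clique_number :: "'a pair_pre_digraph \<Rightarrow> nat" where
  "clique_number G = Max {card K | K. is_clique G K}"

text \<open>
  In a symmetric digraph the out-degree of a vertex is its degree in the undirected graph.
  The maximum is unspecified for the graph without vertices.
\<close>

definition max_degree :: "'a pair_pre_digraph \<Rightarrow> nat" where
  "max_degree G = Max {out_degree (with_proj G) v | v. v \<in> pverts G}"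

definition proper_coloring :: "'a pair_pre_digraph \<Rightarrow> ('a \<Rightarrow> nat) \<Rightarrow> bool" where
  "proper_coloring G f \<longleftrightarrow> (\<forall>(x, y)\<in>parcs G. f x \<noteq> f y)"

definition chromatic_number :: "'a pair_pre_digraph \<Rightarrow> nat" where
  "chromatic_number G = (LEAST k. \<exists>f. f ` pverts G \<subseteq> {..<k} \<and> proper_coloring G f)"

text \<open>The shortest-path distance with unit weights; it is \<open>\<infinity>\<close> between different components.\<close>

definition graph_dist :: "'a pair_pre_digraph \<Rightarrow> 'a \<Rightarrow> 'a \<Rightarrow> ereal" where
  "graph_dist G u v = wf_digraph.\<mu> (with_proj G) (\<lambda>_. 1) u v"

definition exact_distance_graph :: "'a pair_pre_digraph \<Rightarrow> nat \<Rightarrow> 'a pair_pre_digraph" where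
  "exact_distance_graph G p =
     \<lparr>pverts = pverts G,
      parcs = {(u, v). u \<in> pverts G \<and> v \<in> pverts G \<and> graph_dist G u v = ereal (real p)}\<rparr>"

lemma (in wf_digraph) awalk_cost_unit: "awalk_cost (\<lambda>_. 1) c = real (length c)"
  by (induction c) auto

lemma graph_dist_eq_iff:
  assumes "pair_graph G"
  shows "graph_dist G u v = ereal (real n) \<longleftrightarrow>
    (\<exists>c. pre_digraph.awalk (with_proj G) u c v \<and> length c = n) \<and>
    (\<forall>c. pre_digraph.awalk (with_proj G) u c v \<longrightarrow> n \<le> length c)"
    (is "?L = ?R")
proof -
  interpret pair_graph G by (fact assms)
  have d: "graph_dist G u v = (INF c\<in>{c. awalk u c v}. ereal (real (length c)))"
    unfolding graph_dist_def \<mu>_def awalk_cost_unit ..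
  show ?thesis
  proof
    assume ?L
    have ne: "\<exists>c. awalk u c v"
    proof (rule ccontr)
      assume "\<not> ?thesis"
      then have "graph_dist G u v = \<infinity>" by (simp add: d top_ereal_def)
      with \<open>?L\<close> show False by simp
    qed
    define m where "m = (LEAST m. \<exists>c. awalk u c v \<and> length c = m)"
    have ex: "\<exists>c. awalk u c v \<and> length c = m"
      unfolding m_def by (rule LeastI_ex) (use ne in blast)
    have min: "\<And>c. awalk u c v \<Longrightarrow> m \<le> length c"
      unfolding m_def by (rule Least_le) blast
    have "graph_dist G u v = ereal (real m)"
      unfolding d
    proof (rule antisym)
      show "(INF c\<in>{c. awalk u c v}. ereal (real (length c))) \<le> ereal (real m)"
        using ex by (auto intro!: INF_lower2)
      show "ereal (real m) \<le> (INF c\<in>{c. awalk u c v}. ereal (real (length c)))"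
        using min by (auto intro!: INF_greatest)
    qed
    with \<open>?L\<close> have "m = n" by simp
    with ex min show ?R by blast
  next
    assume ?R
    then show ?L
      unfolding d by (intro antisym) (auto intro!: INF_lower2 INF_greatest)
  qed
qed

lemma pair_graph_exact_distance_graph:
  assumes "pair_graph G" and "p > 0"
  shows "pair_graph (exact_distance_graph G p)"
proof -
  interpret pair_graph G by (fact assms)
  have rev: "\<exists>c'. awalk v c' u \<and> length c' = length c" if "awalk u c v" for u v c
    using that
  proof (induction c arbitrary: u)
    case Nil
    then show ?case by (intro exI[of _ "[]"]) (auto simp: awalk_Nil_iff)
  next
    case (Cons e c)
    obtain x where e: "e = (u, x)" and x: "awalk x c v" and eG: "(u, x) \<in> parcs G"
      using Cons.prems by (cases e) (auto simp: awalk_Cons_iff)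
    from Cons.IH[OF x] obtain c' where c': "awalk v c' x" "length c' = length c" by blast
    have xu: "(x, u) \<in> parcs G"
      using eG pair_sym_arcs by (auto simp: symmetric_def dest: symD)
    have "awalk x [(x, u)] u"
      using xu by (auto simp: awalk_Cons_iff awalk_Nil_iff dest: in_arcsD2)
    with c' have "awalk v (c' @ [(x, u)]) u" by (auto intro: awalk_appendI)
    then show ?case using c' by (intro exI[of _ "c' @ [(x, u)]"]) simp
  qed
  have dist_sym: "graph_dist G v u = ereal (real p)" if "graph_dist G u v = ereal (real p)" for u v
    using that rev unfolding graph_dist_eq_iff[OF assms(1)] by metis
  have loop: "graph_dist G u u \<noteq> ereal (real p)" if "u \<in> pverts G" for u
  proof
    assume "graph_dist G u u = ereal (real p)"
    then have min: "\<And>c. awalk u c u \<Longrightarrow> p \<le> length c"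
      unfolding graph_dist_eq_iff[OF assms(1)] by blast
    have "awalk u [] u" using that by (simp add: awalk_Nil_iff)
    from min[OF this] \<open>p > 0\<close> show False by simp
  qed
  have "parcs (exact_distance_graph G p) \<subseteq> pverts G \<times> pverts G"
    by (auto simp: exact_distance_graph_def)
  then have fin: "finite (parcs (exact_distance_graph G p))"
    by (rule finite_subset) (simp add: pair_finite_verts)
  have symm: "symmetric (with_proj (exact_distance_graph G p))"
    unfolding symmetric_def with_proj_simps
    by (rule symI) (auto simp: exact_distance_graph_def intro: dist_sym)
  have "fst e \<noteq> snd e" if "e \<in> parcs (exact_distance_graph G p)" for e
    using that loop by (cases e) (auto simp: exact_distance_graph_def)
  with fin symm show ?thesis
    by unfold_locales (auto simp: exact_distance_graph_def pair_finite_verts)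
qed

lemma exact_distance_graph_1:
  assumes "pair_graph G"
  shows "exact_distance_graph G 1 = G"
proof -
  interpret pair_graph G by (fact assms)
  have "graph_dist G u v = ereal (real 1) \<longleftrightarrow> (u, v) \<in> parcs G" for u v
    unfolding graph_dist_eq_iff[OF assms]
  proof (intro iffI conjI allI impI; (elim conjE exE)?)
    fix c assume "awalk u c v" "length c = 1"
    then show "(u, v) \<in> parcs G"
      by (cases c) (auto simp: awalk_Cons_iff awalk_Nil_iff)
  next
    assume "(u, v) \<in> parcs G"
    then show "\<exists>c. awalk u c v \<and> length c = 1"
      by (intro exI[of _ "[(u, v)]"])
        (auto simp: awalk_Cons_iff awalk_Nil_iff dest: in_arcsD2)
  next
    fix c assume uv: "(u, v) \<in> parcs G" and "awalk u c v"
    then show "1 \<le> length c"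
      using pair_no_loops[OF uv] by (cases c) (auto simp: awalk_Nil_iff)
  qed
  then have "parcs (exact_distance_graph G 1) = parcs G"
    by (auto simp: exact_distance_graph_def dest: in_arcsD1 in_arcsD2)
  then show ?thesis by (simp add: exact_distance_graph_def)
qed

lemma chromatic_number_coloring:
  assumes "pair_graph G"
  shows "\<exists>f. f ` pverts G \<subseteq> {..<chromatic_number G} \<and> proper_coloring G f"
  unfolding chromatic_number_def
proof (rule LeastI_ex)
  interpret pair_graph G by (fact assms)
  obtain f :: "'a \<Rightarrow> nat" and n where f: "f ` pverts G = {..<n}" "inj_on f (pverts G)"
    using finite_imp_inj_to_nat_seg[OF pair_finite_verts] by (auto simp: lessThan_def)
  have "proper_coloring G f"
    unfolding proper_coloring_def
  proof clarify
    fix x y assume "(x, y) \<in> parcs G" "f x = f y"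
    then show False
      using pair_no_loops[of "(x, y)"] inj_onD[OF f(2)] by (auto dest: in_arcsD1 in_arcsD2)
  qed
  with f(1) show "\<exists>k f. f ` pverts G \<subseteq> {..<k} \<and> proper_coloring G f" by blast
qed

lemma clique_number_clique:
  assumes "pair_graph G"
  shows "\<exists>K. is_clique G K \<and> card K = clique_number G"
    and "is_clique G K \<Longrightarrow> card K \<le> clique_number G"
proof -
  interpret pair_graph G by (fact assms)
  have fin: "finite {card K | K. is_clique G K}"
    by (rule finite_subset[of _ "card ` Pow (pverts G)"])
      (use pair_finite_verts in \<open>auto simp: is_clique_def\<close>)
  have "is_clique G {}" by (simp add: is_clique_def)
  then have "{card K | K. is_clique G K} \<noteq> {}" by blast
  from Max_in[OF fin this] show "\<exists>K. is_clique G K \<and> card K = clique_number G"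
    unfolding clique_number_def by auto
  show "is_clique G K \<Longrightarrow> card K \<le> clique_number G"
    unfolding clique_number_def using fin by (auto intro: Max_ge)
qed

end

theory Submission
  imports Defs
begin

text \<open>
  Fix a root in each component and call the vertices at distance \<open>j\<close> from their root the layer \<open>j\<close>.
  In a chordal graph, two vertices of layer \<open>j\<close> that are joined by a path through deeper layers are
  adjacent, since the path closes up to a cycle through the shallower layers. Hence the set \<open>A v\<close> of
  vertices \<open>q = p div 2\<close> layers above \<open>v\<close> and at distance \<open>q\<close> from it is a clique. A clique inside
  a layer has a common neighbour in the layer above, so it has at most \<open>t - 1\<close> vertices.

  Vertices at distance \<open>p\<close> are at most \<open>p\<close> layers apart, so colouring by the layer modulo \<open>p + 1\<close>
  leaves pairs \<open>u, v\<close> in one layer. Some vertex of \<open>A u\<close> and some vertex of \<open>A v\<close> are then adjacent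
  or equal. Let \<open>m v\<close> be the first vertex of \<open>A v\<close> in a perfect elimination order. Then \<open>m u\<close> and
  \<open>m v\<close> are equal, or one is weakly 2-reachable from the other inside its layer; for odd \<open>p\<close> they are
  not equal. A vertex weakly 2-reaches at most \<open>t choose 2\<close> vertices of its layer, itself included,
  so a greedy colouring with this many colours separates \<open>m u\<close> from \<open>m v\<close>. For even \<open>p\<close> the colour
  of \<open>v\<close> also records a neighbour of \<open>m v\<close> on a shortest path to \<open>v\<close>: sharing both \<open>m v\<close> and this
  neighbour would give distance at most \<open>p - 2\<close>.
\<close>

section \<open>Separators and perfect elimination orders\<close>

text \<open>Chordality is stated for cyclic lists of vertices: the chord joins two positions that
  are not cyclically consecutive. The excluded pair of first and last position is the closing edge
  of the cycle.\<close>

locale chordal_graph =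
  fixes V :: "'a set" and E :: "'a \<Rightarrow> 'a \<Rightarrow> bool"
  assumes finite_V: "finite V"
    and E_in_V: "E x y \<Longrightarrow> x \<in> V \<and> y \<in> V"
    and E_sym: "E x y \<Longrightarrow> E y x"
    and E_irrefl: "\<not> E x x"
    and cycle_chord: "\<lbrakk>distinct c; length c \<ge> 4; successively E c; E (last c) (hd c)\<rbrakk> \<Longrightarrow>
      \<exists>i k. Suc i < k \<and> k < length c \<and> \<not> (i = 0 \<and> Suc k = length c) \<and> E (c ! i) (c ! k)"
begin

section \<open>Connectivity inside a vertex set and induced walks\<close>

definition reach :: "'a set \<Rightarrow> 'a \<Rightarrow> 'a \<Rightarrow> bool" where
  "reach S = (\<lambda>a b. E a b \<and> a \<in> S \<and> b \<in> S)\<^sup>*\<^sup>*"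

lemma reach_refl: "reach S x x"
  by (simp add: reach_def)

lemma reach_trans: "reach S x y \<Longrightarrow> reach S y z \<Longrightarrow> reach S x z"
  unfolding reach_def by (rule rtranclp_trans)

lemma reach_edge: "E x y \<Longrightarrow> x \<in> S \<Longrightarrow> y \<in> S \<Longrightarrow> reach S x y"
  unfolding reach_def by auto

lemma reach_sym: "reach S x y \<Longrightarrow> reach S y x"
  unfolding reach_def
  by (rule sympD[OF symp_rtranclp]) (auto simp: symp_def intro: E_sym)

lemma reach_mono: "reach S x y \<Longrightarrow> S \<subseteq> T \<Longrightarrow> reach T x y"
  unfolding reach_def by (rule mono_rtranclp[rule_format]) auto

lemma reach_in: "reach S x y \<Longrightarrow> x \<in> S \<Longrightarrow> y \<in> S"
  unfolding reach_def by (induction rule: rtranclp_induct) auto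

definition walk :: "'a set \<Rightarrow> 'a \<Rightarrow> 'a list \<Rightarrow> 'a \<Rightarrow> bool" where
  "walk S x p y \<longleftrightarrow> p \<noteq> [] \<and> hd p = x \<and> last p = y \<and> set p \<subseteq> S \<and> successively E p"

lemma reach_walk:
  assumes "reach S x y" "x \<in> S"
  shows "\<exists>p. walk S x p y"
  using assms(1) unfolding reach_def
proof (induction rule: rtranclp_induct)
  case base
  then show ?case using assms(2) by (intro exI[of _ "[x]"]) (simp add: walk_def)
next
  case (step y z)
  then obtain p where "walk S x p y" by blast
  with step show ?case
    by (intro exI[of _ "p @ [z]"]) (auto simp: walk_def successively_append_iff)
qed

text \<open>Cuts out the part of a walk strictly between positions \<open>i\<close> and
  \<open>k\<close>. The case \<open>k = length p\<close> cuts off a tail when position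
  \<open>i\<close> already holds the endpoint.\<close>

lemma walk_splice:
  assumes "walk S x p y" "i < length p" "k \<le> length p" "i < k"
    and "k < length p \<Longrightarrow> E (p ! i) (p ! k)" "k = length p \<Longrightarrow> p ! i = y"
  shows "walk S x (take (Suc i) p @ drop k p) y"
proof -
  have p: "p \<noteq> []" "hd p = x" "last p = y" "set p \<subseteq> S" "successively E p"
    using assms(1) by (auto simp: walk_def)
  have s: "successively E (take n p)" "successively E (drop n p)" for n
    using p(5) successively_append_iff[of E "take n p" "drop n p"] by auto
  have l: "last (take (Suc i) p) = p ! i"
    using assms(2) by (simp add: take_Suc_conv_app_nth)
  have h: "drop k p = [] \<or> E (p ! i) (hd (drop k p))"
    using assms(3,5) by (cases "k = length p") (auto simp: hd_drop_conv_nth)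
  have "set (take (Suc i) p @ drop k p) \<subseteq> S"
    using p(4) set_take_subset[of "Suc i" p] set_drop_subset[of k p] by auto
  moreover have "last (take (Suc i) p @ drop k p) = y"
    using assms(3,6) l p(3) by (cases "k = length p") (auto simp: last_drop)
  ultimately show ?thesis
    using p l h s
    by (auto simp: walk_def successively_append_iff)
qed

text \<open>A walk of minimal length works: a repeated vertex or an edge between non-consecutive
  positions would allow a shortcut.\<close>

lemma induced_walk:
  assumes "reach S x y" "x \<in> S"
  obtains p where "walk S x p y" "distinct p"
    "\<And>i k. Suc i < k \<Longrightarrow> k < length p \<Longrightarrow> \<not> E (p ! i) (p ! k)"
proof -
  obtain p where p: "walk S x p y" and min: "\<And>r. walk S x r y \<Longrightarrow> length p \<le> length r"
    using ex_has_least_nat[of "\<lambda>p. walk S x p y" _ length] reach_walk[OF assms] by blast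
  have "distinct p"
  proof (rule ccontr)
    assume "\<not> distinct p"
    then obtain i k where ik: "i < k" "k < length p" "p ! i = p ! k"
      by (metis distinct_conv_nth linorder_neqE_nat)
    have "walk S x (take (Suc i) p @ drop (Suc k) p) y"
    proof (rule walk_splice[OF p])
      show "E (p ! i) (p ! Suc k)" if "Suc k < length p"
        using p that ik(3) successively_conv_nth[of E p] by (auto simp: walk_def)
      show "p ! i = y" if "Suc k = length p"
        using p ik(3) that[symmetric] by (auto simp: walk_def last_conv_nth)
    qed (use ik in auto)
    from min[OF this] ik show False by simp
  qed
  moreover have "\<not> E (p ! i) (p ! k)" if "Suc i < k" "k < length p" for i k
  proof
    assume "E (p ! i) (p ! k)"
    then have "walk S x (take (Suc i) p @ drop k p) y"
      using that by (intro walk_splice[OF p]) auto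
    from min[OF this] that show False by simp
  qed
  ultimately show ?thesis using that p by blast
qed

text \<open>If \<open>x\<close> and \<open>y\<close> were not adjacent, induced paths between them
  through \<open>A\<close> and through \<open>B\<close> would have at least two edges each and would
  close up to a cycle of length at least 4 without a chord.\<close>

lemma separator_adjacent:
  assumes xy: "x \<noteq> y"
    and A: "reach (insert x (insert y A)) x y" and B: "reach (insert x (insert y B)) x y"
    and disj: "A \<inter> B = {}" and anti: "\<And>a b. a \<in> A \<Longrightarrow> b \<in> B \<Longrightarrow> \<not> E a b"
  shows "E x y"
proof (rule ccontr)
  assume nE: "\<not> E x y"
  obtain p where p: "walk (insert x (insert y A)) x p y" "distinct p"
    "\<And>i k. Suc i < k \<Longrightarrow> k < length p \<Longrightarrow> \<not> E (p ! i) (p ! k)"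
    using induced_walk[OF A] by auto
  obtain q where q: "walk (insert x (insert y B)) y q x" "distinct q"
    "\<And>i k. Suc i < k \<Longrightarrow> k < length q \<Longrightarrow> \<not> E (q ! i) (q ! k)"
    using induced_walk[OF reach_sym[OF B]] by auto
  define n m where "n = length p - 1" and "m = length q - 1"
  have pne: "p \<noteq> []" "q \<noteq> []" using p(1) q(1) by (auto simp: walk_def)
  then have lp: "length p = Suc n" and lq: "length q = Suc m"
    by (auto simp: n_def m_def)
  have p0: "p ! 0 = x" "p ! n = y" "q ! 0 = y" "q ! m = x"
    using p(1) q(1) pne by (auto simp: walk_def hd_conv_nth last_conv_nth n_def m_def)
  have pE: "E (p ! i) (p ! Suc i)" if "i < n" for i
    using p(1) lp that successively_conv_nth[of E p] by (auto simp: walk_def)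
  have qE: "E (q ! i) (q ! Suc i)" if "i < m" for i
    using q(1) lq that successively_conv_nth[of E q] by (auto simp: walk_def)
  have n2: "n \<ge> 2"
  proof -
    have "n \<noteq> 0" using p0 xy by metis
    moreover have "n \<noteq> 1" using pE[of 0] p0 nE by auto
    ultimately show ?thesis by simp
  qed
  have m2: "m \<ge> 2"
  proof -
    have "m \<noteq> 0" using p0 xy by metis
    moreover have "m \<noteq> 1" using qE[of 0] p0 nE E_sym by auto
    ultimately show ?thesis by simp
  qed
  have pA: "p ! i \<in> A" if "0 < i" "i < n" for i
  proof -
    have "p ! i \<in> set p" using that lp by simp
    then have "p ! i \<in> insert x (insert y A)" using p(1) by (auto simp: walk_def)
    moreover have "p ! i \<noteq> x" "p ! i \<noteq> y"
      using that p(2) lp nth_eq_iff_index_eq[OF p(2), of i 0] nth_eq_iff_index_eq[OF p(2), of i n] p0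
      by auto
    ultimately show ?thesis by blast
  qed
  have qB: "q ! i \<in> B" if "0 < i" "i < m" for i
  proof -
    have "q ! i \<in> set q" using that lq by simp
    then have "q ! i \<in> insert x (insert y B)" using q(1) by (auto simp: walk_def)
    moreover have "q ! i \<noteq> x" "q ! i \<noteq> y"
      using that q(2) lq nth_eq_iff_index_eq[OF q(2), of i 0] nth_eq_iff_index_eq[OF q(2), of i m] p0
      by auto
    ultimately show ?thesis by blast
  qed
  \<comment> \<open>Each path loses its last vertex, because that is the first vertex of the other
    path.\<close>
  define c where "c = take n p @ take m q"
  have lc: "length c = n + m" using lp lq by (simp add: c_def)
  have c: "c ! i = (if i < n then p ! i else q ! (i - n))" if "i < n + m" for i
    using that lp lq by (auto simp: c_def nth_append)
  have pq: "p ! i \<noteq> q ! k" if "i < n" "k < m" for i k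
  proof (cases "i = 0")
    case True
    have "q ! k \<noteq> q ! m" using that lq nth_eq_iff_index_eq[OF q(2), of k m] by auto
    then show ?thesis using True p0 by simp
  next
    case False
    show ?thesis
    proof (cases "k = 0")
      case True
      have "p ! i \<noteq> p ! n" using that lp nth_eq_iff_index_eq[OF p(2), of i n] by auto
      then show ?thesis using True p0 by simp
    next
      case k: False
      show ?thesis using pA[of i] qB[of k] that disj False k by auto
    qed
  qed
  have "set (take n p) \<inter> set (take m q) = {}"
    unfolding nth_image[symmetric, of n p, unfolded lp, simplified]
      nth_image[symmetric, of m q, unfolded lq, simplified]
    using pq by auto
  then have "distinct c" using p(2) q(2) by (simp add: c_def)
  moreover have "successively E c"
    unfolding successively_conv_nth
  proof (intro allI impI)
    fix i assume "Suc i < length c"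
    then show "E (c ! i) (c ! Suc i)"
      using c[of i] c[of "Suc i"] pE[of i] qE[of "i - n"] lc p0
      by (cases "Suc i = n"; cases "i < n") (auto simp: Suc_diff_le)
  qed
  moreover have "E (last c) (hd c)"
  proof -
    have "last c = q ! (m - 1)"
      using c[of "n + m - 1"] lc n2 m2 by (subst last_conv_nth) auto
    moreover have "hd c = q ! m"
      using c[of 0] n2 lc p0 by (subst hd_conv_nth) auto
    ultimately show ?thesis using qE[of "m - 1"] m2 by simp
  qed
  ultimately obtain i k where ik: "Suc i < k" "k < n + m" "\<not> (i = 0 \<and> Suc k = n + m)"
    "E (c ! i) (c ! k)"
    using cycle_chord[of c] lc n2 m2 by auto
  \<comment> \<open>The chord lies within \<open>p\<close>, lies within \<open>q\<close>, runs from
    \<open>x\<close> into \<open>q\<close>, or joins the interiors of both paths. In the third case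
    \<open>x\<close> is read as the last vertex of \<open>q\<close>.\<close>
  consider "k \<le> n" | "n \<le> i" | "i = 0" "n < k" | "0 < i" "i < n" "n < k"
    by linarith
  then show False
  proof cases
    case 1
    have "E (p ! i) (p ! k)" using ik c[of i] c[of k] p0 1 by (auto split: if_splits)
    then show ?thesis using p(3) ik 1 lp by auto
  next
    case 2
    have "E (q ! (i - n)) (q ! (k - n))" using ik c[of i] c[of k] 2 by auto
    moreover have "Suc (i - n) < k - n" "k - n < length q" using ik 2 lq by auto
    ultimately show ?thesis using q(3) by blast
  next
    case 3
    have "E (q ! (k - n)) (q ! m)" using ik c[of i] c[of k] 3 p0 n2 E_sym by auto
    moreover have "Suc (k - n) < m" using ik 3 by auto
    ultimately show ?thesis using q(3)[of "k - n" m] lq by auto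
  next
    case 4
    have "c ! i \<in> A" "c ! k \<in> B" using c[of i] c[of k] pA[of i] qB[of "k - n"] 4 ik by auto
    then show ?thesis using anti ik(4) by blast
  qed
qed

section \<open>Simplicial vertices and elimination orders\<close>

definition simplicial :: "'a set \<Rightarrow> 'a \<Rightarrow> bool" where
  "simplicial S s \<longleftrightarrow> (\<forall>x\<in>S. \<forall>y\<in>S. E x s \<longrightarrow> E y s \<longrightarrow> x \<noteq> y \<longrightarrow> E x y)"

text \<open>
  Dirac's argument: for a component \<open>C\<close> of the non-neighbours of \<open>v\<close>, the boundary of \<open>C\<close> is a
  clique, and a vertex of \<open>C\<close> that is simplicial in \<open>C\<close> together with its boundary is simplicial in
  \<open>S\<close>.
\<close>

lemma ex_simplicial_nonadjacent:
  assumes "finite S" "v \<in> S" "w \<in> S" "w \<noteq> v" "\<not> E w v"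
  shows "\<exists>s\<in>S. s \<noteq> v \<and> \<not> E s v \<and> simplicial S s"
  using assms
proof (induction "card S" arbitrary: S v w rule: less_induct)
  case less
  define R where "R = {x \<in> S. x \<noteq> v \<and> \<not> E x v}"
  define C where "C = {x. reach R w x}"
  define N where "N = {x \<in> S. x \<notin> C \<and> (\<exists>c\<in>C. E x c)}"
  have wR: "w \<in> R" using less.prems by (simp add: R_def)
  have CR: "C \<subseteq> R" using reach_in[OF _ wR] by (auto simp: C_def)
  have wC: "w \<in> C" by (simp add: C_def reach_refl)
  have Nv: "E x v" "x \<noteq> v" if "x \<in> N" for x
  proof -
    obtain c where c: "c \<in> C" "E x c" "x \<in> S" "x \<notin> C" using \<open>x \<in> N\<close> by (auto simp: N_def)
    have "x \<notin> R"
    proof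
      assume "x \<in> R"
      then have "reach R c x" using c CR by (intro reach_edge) (auto intro: E_sym)
      then have "x \<in> C" using c(1) reach_trans by (auto simp: C_def)
      then show False using c by simp
    qed
    moreover have "x \<noteq> v" using c CR E_sym by (auto simp: R_def)
    ultimately show "E x v" "x \<noteq> v" using c by (auto simp: R_def)
  qed
  have closed: "reach C a b" if "a \<in> C" "b \<in> C" for a b
  proof -
    have "reach C w x" if "reach R w x" for x
      using that unfolding reach_def[of R]
    proof (induction rule: rtranclp_induct)
      case base
      show ?case by (rule reach_refl)
    next
      case (step y z)
      then have "y \<in> C" "z \<in> C"
        unfolding C_def reach_def by (auto intro: rtranclp.rtrancl_into_rtrancl)
      with step show ?case by (metis reach_edge reach_trans)
    qed
    then show ?thesis using that reach_sym reach_trans unfolding C_def by blast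
  qed
  \<comment> \<open>Two boundary vertices are joined through \<open>C\<close> and also through
    \<open>v\<close>, and no vertex of \<open>C\<close> is adjacent to \<open>v\<close>.\<close>
  have Ncl: "E x y" if xy: "x \<in> N" "y \<in> N" "x \<noteq> y" for x y
  proof (rule separator_adjacent[of _ _ C "{v}"])
    obtain a b where ab: "a \<in> C" "E x a" "b \<in> C" "E y b" using xy by (auto simp: N_def)
    have "reach (insert x (insert y C)) x a" "reach (insert x (insert y C)) b y"
      using ab E_sym by (auto intro!: reach_edge)
    moreover have "reach (insert x (insert y C)) a b"
      by (rule reach_mono[OF closed[OF ab(1,3)]]) auto
    ultimately show "reach (insert x (insert y C)) x y" by (meson reach_trans)
    have "reach (insert x (insert y {v})) x v" "reach (insert x (insert y {v})) v y"
      using Nv xy E_sym by (auto intro!: reach_edge)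
    then show "reach (insert x (insert y {v})) x y" by (rule reach_trans)
  qed (use CR xy in \<open>auto simp: R_def\<close>)
  define S' where "S' = C \<union> N"
  have S'S: "S' \<subseteq> S" using CR by (auto simp: S'_def R_def N_def)
  have vS': "v \<notin> S'" using CR Nv by (auto simp: S'_def R_def)
  have card: "card S' < card S"
    using S'S vS' less.prems by (intro psubset_card_mono) auto
  have fin: "finite S'" using S'S less.prems(1) by (rule finite_subset)
  have nbr: "x \<in> S'" if "c \<in> C" "x \<in> S" "E x c" for x c
    using that by (auto simp: S'_def N_def)
  have lift: ?case if "c \<in> C" "simplicial S' c" for c
  proof -
    have "simplicial S c" using that nbr unfolding simplicial_def by blast
    then show ?thesis using that(1) CR by (auto simp: R_def)
  qed
  \<comment> \<open>For a vertex \<open>a\<close> of \<open>S'\<close> with a non-neighbour,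
    induction yields a simplicial vertex not adjacent to \<open>a\<close>. It lies in
    \<open>C\<close>: if \<open>a\<close> is in \<open>N\<close>, because \<open>N\<close> is a
    clique; if no such \<open>a\<close> exists in \<open>N\<close>, because every vertex of
    \<open>N\<close> is adjacent to all the rest of \<open>S'\<close>. If there is no such
    \<open>a\<close> at all, \<open>S'\<close> is a clique and \<open>w\<close> itself
    serves.\<close>
  show ?case
  proof (cases "\<exists>a\<in>N. \<exists>b\<in>S'. b \<noteq> a \<and> \<not> E b a")
    case True
    then obtain a b where ab: "a \<in> N" "b \<in> S'" "b \<noteq> a" "\<not> E b a" by blast
    obtain s where s: "s \<in> S'" "s \<noteq> a" "\<not> E s a" "simplicial S' s"
      using less.hyps[OF card fin _ ab(2-4)] ab(1) by (auto simp: S'_def)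
    then have "s \<in> C" using Ncl ab(1) by (auto simp: S'_def)
    then show ?thesis using lift s by blast
  next
    case N: False
    show ?thesis
    proof (cases "\<exists>a\<in>S'. \<exists>b\<in>S'. b \<noteq> a \<and> \<not> E b a")
      case True
      then obtain a b where ab: "a \<in> S'" "b \<in> S'" "b \<noteq> a" "\<not> E b a" by blast
      obtain s where s: "s \<in> S'" "s \<noteq> a" "\<not> E s a" "simplicial S' s"
        using less.hyps[OF card fin ab] by blast
      have "s \<notin> N" using N s(2,3) ab(1) E_sym by metis
      then have "s \<in> C" using s(1) by (simp add: S'_def)
      then show ?thesis using lift s by blast
    next
      case False
      then have "simplicial S' w" unfolding simplicial_def by blast
      then show ?thesis using lift wC by blast
    qed
  qed
qed

lemma ex_simplicial:
  assumes "finite S" "S \<noteq> {}"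
  shows "\<exists>s\<in>S. simplicial S s"
proof (cases "\<exists>v\<in>S. \<exists>w\<in>S. w \<noteq> v \<and> \<not> E w v")
  case True
  then show ?thesis using ex_simplicial_nonadjacent[OF assms(1)] by blast
next
  case False
  then show ?thesis using assms(2) unfolding simplicial_def by blast
qed

text \<open>A simplicial vertex is removed, the rest is ordered by induction, and the removed vertex
  is placed last.\<close>

lemma perfect_elimination_order:
  assumes "finite S"
  shows "\<exists>ord :: 'a \<Rightarrow> nat. inj_on ord S \<and> ord ` S \<subseteq> {..<card S} \<and>
    (\<forall>s\<in>S. \<forall>x\<in>S. \<forall>y\<in>S. E x s \<longrightarrow> E y s \<longrightarrow> ord x < ord s \<longrightarrow> ord y < ord s \<longrightarrow> x \<noteq> y \<longrightarrow> E x y)"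
  using assms
proof (induction "card S" arbitrary: S)
  case 0
  then show ?case by auto
next
  case (Suc n)
  from Suc.hyps(2) have "S \<noteq> {}" by auto
  then obtain s where s: "s \<in> S" "simplicial S s" using ex_simplicial Suc.prems by blast
  define T where "T = S - {s}"
  have T: "n = card T" "finite T" "S = insert s T" "s \<notin> T"
    using Suc s by (auto simp: T_def)
  from Suc.hyps(1)[OF T(1,2)] obtain ord :: "'a \<Rightarrow> nat" where ord: "inj_on ord T" "ord ` T \<subseteq> {..<n}"
    "\<forall>s\<in>T. \<forall>x\<in>T. \<forall>y\<in>T. E x s \<longrightarrow> E y s \<longrightarrow> ord x < ord s \<longrightarrow> ord y < ord s \<longrightarrow> x \<noteq> y \<longrightarrow> E x y"
    using T(1) by auto
  have lt: "ord x < n" if "x \<in> T" for x using ord(2) that by auto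
  have "inj_on (ord(s := n)) S"
    unfolding T(3) using ord(1) T(4) lt by (auto simp: inj_on_def)
  moreover have "(ord(s := n)) ` S \<subseteq> {..<card S}"
    unfolding T(3) using T lt by (auto simp: less_SucI)
  moreover have "E x y" if "z \<in> S" "x \<in> S" "y \<in> S" "E x z" "E y z" "(ord(s := n)) x < (ord(s := n)) z"
    "(ord(s := n)) y < (ord(s := n)) z" "x \<noteq> y" for x y z
  proof (cases "z = s")
    case True
    then show ?thesis using s that unfolding simplicial_def by blast
  next
    case False
    then have "z \<in> T" "ord z < n" using that T(3) lt by auto
    then have "x \<noteq> s" "y \<noteq> s" using that False by auto
    then show ?thesis
      using ord(3)[rule_format, of z x y] that False T(3) \<open>z \<in> T\<close> by simp
  qed
  ultimately show ?case by (intro exI[of _ "ord(s := n)"]) blast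
qed

end

section \<open>Layers\<close>

text \<open>
  \<open>lev\<close> stands for the distance to a root chosen in each component, \<open>ord\<close> for a perfect
  elimination order.
\<close>

locale layered_chordal_graph = chordal_graph V E
  for V :: "'a set" and E :: "'a \<Rightarrow> 'a \<Rightarrow> bool" +
  fixes lev :: "'a \<Rightarrow> nat" and ord :: "'a \<Rightarrow> nat" and t :: nat
  assumes lev_edge: "E x y \<Longrightarrow> lev y \<le> Suc (lev x)"
    and lev_parent: "lev x = Suc n \<Longrightarrow> \<exists>w. E w x \<and> lev w = n"
    and lev_root: "lev x = 0 \<Longrightarrow> lev y = 0 \<Longrightarrow> E\<^sup>*\<^sup>* x y \<Longrightarrow> x = y"
    and inj_ord: "inj_on ord V"
    and ord_elim: "\<lbrakk>E x s; E y s; ord x < ord s; ord y < ord s; x \<noteq> y\<rbrakk> \<Longrightarrow> E x y"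
    and clique_card: "K \<subseteq> V \<Longrightarrow> (\<And>x y. x \<in> K \<Longrightarrow> y \<in> K \<Longrightarrow> x \<noteq> y \<Longrightarrow> E x y) \<Longrightarrow> card K \<le> t"
    and t_ge_2: "t \<ge> 2"
begin

section \<open>Adjacency and cliques inside a layer\<close>

lemma relpowp_sym: "(E ^^ n) x y \<Longrightarrow> (E ^^ n) y x"
proof (induction n arbitrary: x)
  case (Suc n)
  then obtain w where "E x w" "(E ^^ n) w y" by (meson relpowp_Suc_E2)
  with Suc.IH show ?case by (blast intro: relpowp_Suc_I E_sym)
qed simp

lemma reach_rtranclp: "reach S x y \<Longrightarrow> E\<^sup>*\<^sup>* x y"
  unfolding reach_def by (rule mono_rtranclp[rule_format]) auto

lemma lev_relpowp: "(E ^^ n) x y \<Longrightarrow> lev y \<le> lev x + n"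
proof (induction n arbitrary: y)
  case (Suc n)
  then show ?case using lev_edge by (fastforce elim!: relpowp_Suc_E)
qed simp

lemma reach_root: "\<exists>r. lev r = 0 \<and> reach {w. lev w \<le> lev x} x r"
proof (induction "lev x" arbitrary: x)
  case 0
  then show ?case by (intro exI[of _ x]) (simp add: reach_refl)
next
  case (Suc n)
  then obtain w where w: "E w x" "lev w = n" using lev_parent by metis
  with Suc.hyps(1)[of w] obtain r where "lev r = 0" "reach {v. lev v \<le> n} w r" by auto
  moreover from this have "reach {v. lev v \<le> lev x} w r"
    using Suc.hyps(2) by (auto elim: reach_mono)
  moreover have "reach {v. lev v \<le> lev x} x w"
    using w Suc.hyps(2) by (intro reach_edge) (auto intro: E_sym)
  ultimately show ?case using reach_trans by blast
qed

text \<open>Besides the given path through deeper layers there is one through shallower layers, by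
  way of the common root. No edge joins a deeper to a shallower layer, since levels change by at
  most 1 along an edge, so \<open>separator_adjacent\<close> applies.\<close>

lemma layer_adjacent:
  assumes "lev x = j" "lev y = j" "x \<noteq> y" "reach (insert x (insert y {w. lev w > j})) x y"
  shows "E x y"
proof -
  have xy: "E\<^sup>*\<^sup>* x y" using assms(4) by (rule reach_rtranclp)
  \<comment> \<open>In layer 0 both vertices would be the root of the same component.\<close>
  have "j \<noteq> 0" using lev_root[OF _ _ xy] assms(1-3) by auto
  then obtain n where n: "j = Suc n" by (cases j) auto
  have down: "\<exists>r. lev r = 0 \<and> reach (insert z {w. lev w < j}) z r" if "lev z = j" for z
  proof -
    obtain w where w: "E w z" "lev w = n" using lev_parent \<open>lev z = j\<close> n by blast
    obtain r where "lev r = 0" "reach {v. lev v \<le> lev w} w r" using reach_root by blast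
    moreover from this have "reach (insert z {w. lev w < j}) w r"
      using w n by (auto elim: reach_mono)
    moreover have "reach (insert z {w. lev w < j}) z w"
      using w n by (intro reach_edge) (auto intro: E_sym)
    ultimately show ?thesis using reach_trans by blast
  qed
  obtain r where r: "lev r = 0" "reach (insert x {w. lev w < j}) x r" using down assms(1) by blast
  obtain s where s: "lev s = 0" "reach (insert y {w. lev w < j}) y s" using down assms(2) by blast
  have "E\<^sup>*\<^sup>* r s"
    using reach_rtranclp[OF reach_sym[OF r(2)]] xy reach_rtranclp[OF s(2)] by simp
  with r(1) s(1) have "r = s" by (rule lev_root)
  have "reach (insert x (insert y {w. lev w < j})) x r"
    "reach (insert x (insert y {w. lev w < j})) r y"
    using r(2) reach_sym[OF s(2)] \<open>r = s\<close> by (auto elim: reach_mono)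
  then have "reach (insert x (insert y {w. lev w < j})) x y" by (rule reach_trans)
  with assms(3,4) show ?thesis
  proof (rule separator_adjacent)
    show "\<not> E a b" if "a \<in> {w. j < lev w}" "b \<in> {w. lev w < j}" for a b
      using that lev_edge[of b a] E_sym by fastforce
  qed auto
qed

text \<open>
  If \<open>z\<close> has as many neighbours in \<open>K\<close> as possible and misses \<open>y\<close>, then a parent \<open>w\<close> of \<open>y\<close> misses
  some neighbour \<open>x\<close> of \<open>z\<close> in \<open>K\<close>, and \<open>z, x, y, w\<close> is a chordless 4-cycle.
\<close>

lemma layer_clique_parent:
  assumes K: "finite K" "K \<noteq> {}" "\<And>x. x \<in> K \<Longrightarrow> lev x = Suc n"
    and clique: "\<And>x y. x \<in> K \<Longrightarrow> y \<in> K \<Longrightarrow> x \<noteq> y \<Longrightarrow> E x y"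
  shows "\<exists>z. lev z = n \<and> (\<forall>x\<in>K. E z x)"
proof -
  define N where "N z = {x \<in> K. E z x}" for z
  obtain x0 where "x0 \<in> K" using K(2) by blast
  then obtain z0 where "lev z0 = n" using lev_parent K(3) by blast
  moreover have "card (N z) \<le> card K" for z
    using K(1) by (auto simp: N_def intro: card_mono)
  ultimately obtain z where z: "lev z = n" and max: "\<And>w. lev w = n \<Longrightarrow> card (N w) \<le> card (N z)"
    using ex_has_greatest_nat[of "\<lambda>z. lev z = n" z0 "\<lambda>z. card (N z)" "Suc (card K)"]
    by (auto simp: less_Suc_eq_le)
  have "E z y" if y: "y \<in> K" for y
  proof (rule ccontr)
    assume zy: "\<not> E z y"
    obtain w where w: "E w y" "lev w = n" using lev_parent K(3) y by blast
    have "\<not> N z \<subseteq> N w"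
    proof
      assume "N z \<subseteq> N w"
      then have "N z \<subset> N w" using y w zy by (auto simp: N_def)
      then have "card (N z) < card (N w)" using K(1) by (intro psubset_card_mono) (auto simp: N_def)
      with max[OF w(2)] show False by simp
    qed
    then obtain x where x: "x \<in> K" "E z x" "\<not> E w x" by (auto simp: N_def)
    have xy: "E x y" "x \<noteq> y" "z \<noteq> w" using clique x y zy w by blast+
    have "E z w"
    proof (rule layer_adjacent[OF z w(2) xy(3)])
      have "reach (insert z (insert w {v. lev v > n})) z x"
        "reach (insert z (insert w {v. lev v > n})) x y"
        "reach (insert z (insert w {v. lev v > n})) y w"
        using x y w xy K(3) E_sym by (auto intro!: reach_edge)
      then show "reach (insert z (insert w {v. lev v > n})) z w" by (meson reach_trans)
    qed
    define c where "c = [z, x, y, w]"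
    have "lev x = Suc n" "lev y = Suc n" using K(3) x(1) y by blast+
    then have "distinct c" using z w(2) xy(2,3) by (auto simp: c_def)
    moreover have "successively E c" "E (last c) (hd c)" "length c \<ge> 4"
      using x(2) xy(1) E_sym[OF w(1)] E_sym[OF \<open>E z w\<close>] by (simp_all add: c_def)
    ultimately obtain i k where ik: "Suc i < k" "k < length c" "\<not> (i = 0 \<and> Suc k = length c)"
      "E (c ! i) (c ! k)" using cycle_chord by blast
    then have "(i = 0 \<and> k = 2) \<or> (i = 1 \<and> k = 3)" by (auto simp: c_def)
    then show False using ik(4) zy x(3) E_sym[of x w] by (auto simp: c_def numeral_eq_Suc)
  qed
  with z show ?thesis by blast
qed

text \<open>A common neighbour in the next shallower layer extends \<open>K\<close> to a larger
  clique. In layer 0 a clique has at most one vertex, which suffices since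
  \<open>t \<ge> 2\<close>.\<close>

lemma layer_clique_card:
  assumes K: "K \<subseteq> V" "\<And>x. x \<in> K \<Longrightarrow> lev x = j"
    and clique: "\<And>x y. x \<in> K \<Longrightarrow> y \<in> K \<Longrightarrow> x \<noteq> y \<Longrightarrow> E x y"
  shows "card K < t"
proof (cases "K = {} \<or> j = 0")
  case True
  have "x = y" if "x \<in> K" "y \<in> K" for x y
    using that True clique[OF that] K(2) lev_root[of x y] by auto
  then have "card K \<le> Suc 0"
    using finite_subset[OF K(1) finite_V] by (simp add: card_le_Suc0_iff_eq)
  then show ?thesis using t_ge_2 by simp
next
  case False
  have fin: "finite K" using K(1) finite_V by (rule finite_subset)
  obtain n where n: "j = Suc n" using False by (cases j) auto
  obtain z where z: "lev z = n" "\<And>x. x \<in> K \<Longrightarrow> E z x"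
    using layer_clique_parent[of K n, OF fin _ _ clique] K(2) n False by blast
  have "z \<notin> K" using K(2)[of z] z(1) n by fastforce
  moreover have "card (insert z K) \<le> t"
  proof (rule clique_card)
    show "insert z K \<subseteq> V" using z(2) K(1) False E_in_V by blast
    show "E x y" if "x \<in> insert z K" "y \<in> insert z K" "x \<noteq> y" for x y
      using that z(2) E_sym[OF z(2)] clique by auto
  qed
  ultimately show ?thesis using fin by simp
qed

text \<open>The ancestors of \<open>v\<close>, \<open>q\<close> generations back. Stating the level
  condition by addition makes the set empty when \<open>q\<close> exceeds
  \<open>lev v\<close>.\<close>

definition anc :: "nat \<Rightarrow> 'a \<Rightarrow> 'a set" where
  "anc q v = {x. (E ^^ q) x v \<and> lev x + q = lev v}"

lemma anc_nonempty: "q \<le> lev v \<Longrightarrow> anc q v \<noteq> {}"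
proof (induction q)
  case 0
  then show ?case by (auto simp: anc_def)
next
  case (Suc q)
  then obtain x where x: "(E ^^ q) x v" "lev x + q = lev v" by (auto simp: anc_def)
  with Suc.prems obtain n where n: "lev x = Suc n" by (cases "lev x") auto
  then obtain w where "E w x" "lev w = n" using lev_parent by blast
  then have "w \<in> anc (Suc q) v" using x n relpowp_Suc_I2[of E w x q v] by (simp add: anc_def)
  then show ?case by blast
qed

lemma anc_in_V: "v \<in> V \<Longrightarrow> anc q v \<subseteq> V"
proof
  fix x assume "v \<in> V" "x \<in> anc q v"
  then have "v \<in> V" "(E ^^ q) x v" by (simp_all add: anc_def)
  then show "x \<in> V"
    by (metis E_in_V relpowp_E2)
qed

text \<open>A walk of length \<open>q\<close> from \<open>x\<close> to \<open>v\<close> must go one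
  layer deeper at every step, so it stays deeper than \<open>x\<close> after its start.\<close>

lemma anc_reach: "x \<in> anc q v \<Longrightarrow> reach (insert x {w. lev w > lev x}) x v"
proof (induction q arbitrary: v)
  case 0
  then show ?case by (simp add: anc_def reach_refl)
next
  case (Suc q)
  then obtain w where w: "(E ^^ q) x w" "E w v" "lev x + Suc q = lev v"
    by (auto simp: anc_def elim: relpowp_Suc_E)
  have "lev w \<le> lev x + q" "lev v \<le> Suc (lev w)" using w lev_relpowp lev_edge by blast+
  then have l: "lev w = lev x + q" using w by simp
  then have "reach (insert x {w. lev w > lev x}) x w" using Suc.IH w by (simp add: anc_def)
  moreover have "reach (insert x {w. lev w > lev x}) w v"
  proof (rule reach_edge[OF w(2)])
    show "w \<in> insert x {w. lev w > lev x}" using w(1) l by (cases "q = 0") auto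
    show "v \<in> insert x {w. lev w > lev x}" using w(3) by auto
  qed
  ultimately show ?case by (rule reach_trans)
qed

text \<open>A walk of length \<open>n\<close> from \<open>u\<close> can come up to layer
  \<open>j\<close> only with its last step, and the assumption on its endpoint excludes
  that.\<close>

lemma reach_above:
  "\<lbrakk>(E ^^ n) u w; j + n \<le> lev u; j < lev w\<rbrakk> \<Longrightarrow> reach {z. lev z > j} u w"
proof (induction n arbitrary: w)
  case 0
  then show ?case by (simp add: reach_refl)
next
  case (Suc n)
  then obtain w' where w': "(E ^^ n) u w'" "E w' w" by (auto elim: relpowp_Suc_E)
  have "lev u \<le> lev w' + n" using lev_relpowp[OF relpowp_sym[OF w'(1)]] .
  then have "lev w' > j" using Suc.prems by simp
  moreover from this have "reach {z. lev z > j} u w'" using Suc.IH w' Suc.prems by simp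
  ultimately show ?case using w' Suc.prems by (auto intro: reach_trans reach_edge)
qed

text \<open>Either \<open>w\<close> has come up to layer \<open>lev u - q\<close> and is itself an
  ancestor, or the walk from \<open>u\<close> to \<open>w\<close> stays deeper and any ancestor
  reaches \<open>w\<close> by way of \<open>u\<close>. The membership of \<open>w\<close> allows an
  edge at \<open>w\<close> to be appended later.\<close>

lemma anc_reach_within:
  assumes "(E ^^ q) u w" "q \<le> lev u"
  shows "\<exists>x\<in>anc q u. reach (insert x {z. lev z > lev u - q}) x w \<and> w \<in> insert x {z. lev z > lev u - q}"
proof (cases "lev w \<le> lev u - q")
  case True
  have "lev u \<le> lev w + q" using lev_relpowp[OF relpowp_sym[OF assms(1)]] .
  then have "w \<in> anc q u" using True assms relpowp_sym by (auto simp: anc_def)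
  then show ?thesis using reach_refl by blast
next
  case False
  obtain x where x: "x \<in> anc q u" using anc_nonempty[OF assms(2)] by blast
  then have "lev x = lev u - q" by (auto simp: anc_def)
  then have "reach (insert x {z. lev z > lev u - q}) x u" using anc_reach[OF x] by simp
  moreover have "reach (insert x {z. lev z > lev u - q}) u w"
    by (rule reach_mono[OF reach_above[OF assms(1)]]) (use assms(2) False in auto)
  ultimately have "reach (insert x {z. lev z > lev u - q}) x w" by (rule reach_trans)
  then show ?thesis using x False by auto
qed

lemma anc_lev: "x \<in> anc q u \<Longrightarrow> lev x = lev u - q"
  by (auto simp: anc_def)

text \<open>Both ancestors are joined to \<open>u\<close>, hence to each other, through deeper
  layers.\<close>

lemma anc_clique: "x \<in> anc q u \<Longrightarrow> y \<in> anc q u \<Longrightarrow> x \<noteq> y \<Longrightarrow> E x y"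
proof (rule layer_adjacent[of _ "lev u - q"])
  assume xy: "x \<in> anc q u" "y \<in> anc q u"
  let ?S = "insert x (insert y {w. lev w > lev u - q})"
  have "reach ?S x u"
    by (rule reach_mono[OF anc_reach[OF xy(1)]]) (auto simp: anc_lev[OF xy(1)])
  moreover have "reach ?S y u"
    by (rule reach_mono[OF anc_reach[OF xy(2)]]) (auto simp: anc_lev[OF xy(2)])
  ultimately show "reach ?S x y" by (meson reach_trans reach_sym)
qed (auto dest: anc_lev)

text \<open>Here \<open>w\<close> and \<open>w'\<close> are the middle of a walk from
  \<open>u\<close> to \<open>v\<close> of length \<open>2 * q\<close> or \<open>2 * q + 1\<close>.
  Ancestors of \<open>u\<close> and \<open>v\<close> are joined through this middle without leaving
  the deeper layers, so \<open>layer_adjacent\<close> applies.\<close>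

lemma anc_join:
  assumes "(E ^^ q) u w" "(E ^^ q) v w'" "w = w' \<or> E w w'" "lev u = lev v" "q \<le> lev u"
  shows "\<exists>x\<in>anc q u. \<exists>y\<in>anc q v. x = y \<or> E x y"
proof -
  obtain x where x: "x \<in> anc q u" "reach (insert x {z. lev z > lev u - q}) x w"
    "w \<in> insert x {z. lev z > lev u - q}"
    using anc_reach_within[OF assms(1,5)] by blast
  obtain y where y: "y \<in> anc q v" "reach (insert y {z. lev z > lev u - q}) y w'"
    "w' \<in> insert y {z. lev z > lev u - q}"
    using anc_reach_within[OF assms(2)] assms(4,5) by auto
  let ?S = "insert x (insert y {z. lev z > lev u - q})"
  have 1: "reach ?S x w" "reach ?S w' y"
    using x(2) reach_sym[OF y(2)] by (auto elim!: reach_mono)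
  have 2: "reach ?S w w'"
    using assms(3) x(3) y(3) reach_refl by (auto intro: reach_edge)
  have "reach ?S x y" using 1 2 by (meson reach_trans)
  then have "x = y \<or> E x y"
    using layer_adjacent[of x "lev u - q" y] anc_lev[OF x(1)] anc_lev[OF y(1)] assms(4) by auto
  then show ?thesis using x y by blast
qed

text \<open>The walk runs from \<open>u\<close> up to the common root and back down to
  \<open>v\<close>.\<close>

lemma same_layer_dist:
  assumes "(E ^^ n) u v" "lev u = a" "lev v = a"
  shows "(E ^^ (2 * a)) u v"
proof -
  obtain r where r: "r \<in> anc a u" using anc_nonempty[of a u] assms(2) by auto
  obtain s where s: "s \<in> anc a v" using anc_nonempty[of a v] assms(3) by auto
  have rs: "(E ^^ a) r u" "(E ^^ a) s v" "lev r = 0" "lev s = 0"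
    using r s assms by (auto simp: anc_def)
  have "E\<^sup>*\<^sup>* r s"
    using rs(1) assms(1) relpowp_sym[OF rs(2)] by (meson relpowp_imp_rtranclp rtranclp_trans)
  then have "r = s" using rs lev_root by blast
  then have "(E ^^ (a + a)) u v" using relpowp_trans[OF relpowp_sym[OF rs(1)]] rs(2) by simp
  then show ?thesis by (simp add: mult_2)
qed

section \<open>Weak reachability within a layer\<close>

definition lower :: "'a \<Rightarrow> 'a set" where
  "lower y = {z. E z y \<and> lev z = lev y \<and> ord z < ord y}"

text \<open>The vertices weakly 2-reachable from \<open>y\<close> inside its layer, except \<open>y\<close>.\<close>

definition wreach2 :: "'a \<Rightarrow> 'a set" where
  "wreach2 y = (\<Union>z\<in>lower y. insert z (lower z))"

lemma lower_in_V: "lower y \<subseteq> V"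
  using E_in_V by (auto simp: lower_def)

lemma finite_lower: "finite (lower y)"
  using lower_in_V finite_V by (rule finite_subset)

lemma lower_clique: "x \<in> lower y \<Longrightarrow> z \<in> lower y \<Longrightarrow> x \<noteq> z \<Longrightarrow> E x z"
  using ord_elim by (auto simp: lower_def)

text \<open>The earlier neighbours of \<open>y\<close> in its layer form a clique by the elimination
  order, and adding \<open>y\<close> keeps it a clique.\<close>

lemma card_insert_lower: "y \<in> V \<Longrightarrow> card (insert y (lower y)) < t"
proof (rule layer_clique_card[of _ "lev y"])
  show "insert y (lower y) \<subseteq> V" if "y \<in> V" using that lower_in_V by blast
  show "lev x = lev y" if "x \<in> insert y (lower y)" for x using that by (auto simp: lower_def)
  have y: "E x y" if "x \<in> lower y" for x using that by (simp add: lower_def)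
  show "E x z" if "x \<in> insert y (lower y)" "z \<in> insert y (lower y)" "x \<noteq> z" for x z
    using that lower_clique y E_sym by blast
qed

text \<open>
  Adding to \<open>Z\<close> its \<open>ord\<close>-largest element \<open>z\<close> adds to the union at most \<open>t - 1 - card Z\<close> new
  vertices, because \<open>Z\<close> is contained in \<open>lower z\<close>.
\<close>

lemma card_Union_insert_lower:
  assumes "finite Z" "Z \<subseteq> V" "\<And>x. x \<in> Z \<Longrightarrow> lev x = j"
    "\<And>x y. x \<in> Z \<Longrightarrow> y \<in> Z \<Longrightarrow> x \<noteq> y \<Longrightarrow> E x y"
  shows "card (\<Union>z\<in>Z. insert z (lower z)) + ((t - card Z) choose 2) \<le> t choose 2"
  using assms
proof (induction "card Z" arbitrary: Z)
  case 0
  then show ?case by simp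
next
  case (Suc n)
  have "Z \<noteq> {}" using Suc.hyps(2) by auto
  then obtain z where z: "z \<in> Z" "\<And>x. x \<in> Z \<Longrightarrow> ord x \<le> ord z"
    using Max_in[of "ord ` Z"] Max_ge[of "ord ` Z"] Suc.prems(1)
    by (metis (no_types, lifting) empty_is_image finite_imageI imageE image_eqI)
  define Y where "Y = Z - {z}"
  have Y: "n = card Y" "finite Y" "Z = insert z Y" "z \<notin> Y"
    using Suc.hyps(2) Suc.prems(1) z(1) by (auto simp: Y_def)
  have lt: "ord x < ord z" if "x \<in> Y" for x
  proof -
    have "ord x \<noteq> ord z"
      using that Y(3,4) Suc.prems(2) inj_onD[OF inj_ord, of x z] by auto
    then show ?thesis using z(2)[of x] that Y(3) by simp
  qed
  have Yb: "Y \<subseteq> lower z"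
    using lt Y(3,4) Suc.prems(3,4) by (auto simp: lower_def)
  let ?U = "\<Union>z\<in>Y. insert z (lower z)"
  have IH: "card ?U + ((t - n) choose 2) \<le> t choose 2"
    using Suc.hyps(1)[OF Y(1,2)] Suc.prems(2-4) Y(1,3) by auto
  have cz: "card (insert z (lower z)) < t" using card_insert_lower z(1) Suc.prems(2) by blast
  \<comment> \<open>The \<open>n\<close> vertices of \<open>Y\<close> are already counted in the
    union over \<open>Y\<close>, so at most \<open>t - 1 - n\<close> vertices are new. Pascal's rule
    below matches this with the drop of the binomial coefficient.\<close>
  have "(\<Union>z\<in>Z. insert z (lower z)) \<subseteq> ?U \<union> (insert z (lower z) - Y)"
    unfolding Y(3) by auto
  then have "card (\<Union>z\<in>Z. insert z (lower z)) \<le> card ?U + card (insert z (lower z) - Y)"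
    using Y(2) finite_lower by (intro order.trans[OF card_mono card_Un_le]) auto
  also have "card (insert z (lower z) - Y) = card (insert z (lower z)) - n"
    using Yb Y(1,2) by (subst card_Diff_subset) auto
  finally have "card (\<Union>z\<in>Z. insert z (lower z)) \<le> card ?U + (t - Suc n)" using cz by linarith
  moreover have "(t - n) choose 2 = (t - Suc n) + ((t - Suc n) choose 2)"
  proof -
    have "n < t"
    proof -
      have "card Y \<le> card (insert z (lower z))" using Yb finite_lower by (intro card_mono) auto
      then show ?thesis using cz Y(1) by simp
    qed
    then have "t - n = Suc (t - Suc n)" by simp
    then show ?thesis by (simp add: numeral_2_eq_2)
  qed
  ultimately show ?case using IH Suc.hyps(2) by simp
qed

text \<open>The set \<open>lower y\<close> has at most \<open>t - 2\<close> vertices, so the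
  binomial coefficient left over in \<open>card_Union_insert_lower\<close> is positive. The strict
  inequality leaves a colour for \<open>y\<close> itself.\<close>

lemma card_wreach2:
  assumes "y \<in> V"
  shows "card (wreach2 y) < t choose 2"
proof -
  have "card (wreach2 y) + ((t - card (lower y)) choose 2) \<le> t choose 2"
    unfolding wreach2_def
    by (rule card_Union_insert_lower[OF finite_lower lower_in_V _ lower_clique])
      (auto simp: lower_def)
  moreover have "(t - card (lower y)) choose 2 > 0"
  proof -
    have "Suc (card (lower y)) < t"
      using card_insert_lower[OF assms] card_insert_disjoint[OF finite_lower, of y y]
      by (simp add: lower_def)
    then show ?thesis by simp
  qed
  ultimately show ?thesis by linarith
qed

text \<open>Greedy colouring along \<open>ord\<close>: the vertices in \<open>wreach2 y\<close>
  precede \<open>y\<close> and are too few to use up all colours.\<close>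

lemma wreach2_coloring:
  "\<exists>f. (\<forall>x. f x < t choose 2) \<and> (\<forall>y\<in>V. \<forall>x\<in>wreach2 y. f x \<noteq> f y)"
proof -
  have pos: "t choose 2 > 0" using t_ge_2 by simp
  have wV: "wreach2 y \<subseteq> V" for y using lower_in_V by (fastforce simp: wreach2_def)
  have wlt: "ord x < ord y" if "x \<in> wreach2 y" for x y
    using that by (auto simp: wreach2_def lower_def)
  have "\<exists>f. (\<forall>x. f x < t choose 2) \<and> (\<forall>y\<in>V. ord y < n \<longrightarrow> (\<forall>x\<in>wreach2 y. f x \<noteq> f y))" for n
  proof (induction n)
    case 0
    show ?case using pos by (intro exI[of _ "\<lambda>_. 0"]) simp
  next
    case (Suc n)
    then obtain f where f: "\<And>x. f x < t choose 2"
      "\<And>y x. y \<in> V \<Longrightarrow> ord y < n \<Longrightarrow> x \<in> wreach2 y \<Longrightarrow> f x \<noteq> f y" by blast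
    show ?case
    proof (cases "\<exists>v\<in>V. ord v = n")
      case False
      then show ?thesis using f by (intro exI[of _ f]) (auto simp: less_Suc_eq)
    next
      case True
      then obtain v where v: "v \<in> V" "ord v = n" by blast
      have "card (f ` wreach2 v) < card {..<t choose 2}"
        using card_wreach2[OF v(1)] card_image_le[OF finite_subset[OF wV finite_V], of f v] by simp
      then have "\<not> {..<t choose 2} \<subseteq> f ` wreach2 v"
        using card_mono[OF finite_imageI[OF finite_subset[OF wV finite_V]]] by (metis not_le)
      then obtain c where c: "c < t choose 2" "c \<notin> f ` wreach2 v" by auto
      show ?thesis
      proof (intro exI[of _ "f(v := c)"] conjI allI ballI impI)
        fix x show "(f(v := c)) x < t choose 2" using f c by simp
      next
        fix y x assume y: "y \<in> V" "ord y < Suc n" "x \<in> wreach2 y"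
        then have lt: "ord x < ord y" using wlt by blast
        show "(f(v := c)) x \<noteq> (f(v := c)) y"
        proof (cases "y = v")
          case True
          then show ?thesis using c lt y by auto
        next
          case False
          \<comment> \<open>Here \<open>y\<close> precedes \<open>v\<close> and \<open>x\<close>
            precedes \<open>y\<close>, so recolouring \<open>v\<close> affects neither.\<close>
          then have "ord y \<noteq> n" using inj_onD[OF inj_ord, of y v] v y by auto
          then show ?thesis using f y lt v False by auto
        qed
      qed
    qed
  qed
  from this[of "Suc (Max (ord ` V))"] show ?thesis
    using finite_V by (auto simp: less_Suc_eq_le)
qed

section \<open>The first ancestor in the elimination order\<close>

definition least_anc :: "nat \<Rightarrow> 'a \<Rightarrow> 'a" where
  "least_anc q v = arg_min_on ord (anc q v)"

lemma least_anc:
  assumes "v \<in> V" "q \<le> lev v"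
  shows "least_anc q v \<in> anc q v" "x \<in> anc q v \<Longrightarrow> ord (least_anc q v) \<le> ord x"
  using arg_min_if_finite[of "anc q v" ord] arg_min_least[of "anc q v" x ord] anc_nonempty[OF assms(2)]
    finite_subset[OF anc_in_V[OF assms(1)] finite_V]
  by (auto simp: least_anc_def)

lemma least_anc_cases:
  assumes "v \<in> V" "q \<le> lev v" "x \<in> anc q v"
  shows "least_anc q v = x \<or> E (least_anc q v) x \<and> ord (least_anc q v) < ord x"
proof -
  have "least_anc q v \<in> V" "x \<in> V"
    using least_anc(1)[OF assms(1,2)] assms anc_in_V by blast+
  then have "ord (least_anc q v) = ord x \<Longrightarrow> least_anc q v = x" using inj_onD[OF inj_ord] by blast
  then show ?thesis
    using least_anc[OF assms(1,2)] anc_clique[OF _ assms(3)] assms(3) by (auto simp: le_less)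
qed

lemma adjacent_wreach2:
  assumes "E x y" "lev x = lev y"
  shows "x \<in> wreach2 y \<or> y \<in> wreach2 x"
proof -
  have "ord x \<noteq> ord y" using inj_onD[OF inj_ord, of x y] E_in_V[OF assms(1)] assms(1) E_irrefl by auto
  then have "x \<in> lower y \<or> y \<in> lower x"
    using assms E_sym[OF assms(1)] by (auto simp: lower_def)
  then show ?thesis unfolding wreach2_def by blast
qed

text \<open>Let \<open>a\<close> and \<open>b\<close> be the least ancestors of \<open>u\<close> and
  \<open>v\<close>. Either \<open>b = y\<close>, or \<open>x\<close> and \<open>b\<close> are both
  earlier neighbours of \<open>y\<close>; so \<open>x\<close> and \<open>b\<close> are adjacent. If
  \<open>x\<close> precedes \<open>b\<close>, then \<open>b\<close> weakly reaches \<open>a\<close>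
  by way of \<open>x\<close>. Otherwise \<open>b\<close> is an earlier neighbour of
  \<open>x\<close>, as is \<open>a\<close> unless \<open>a = x\<close>, so \<open>a\<close> and
  \<open>b\<close> are adjacent.\<close>

lemma least_anc_wreach2:
  assumes uv: "u \<in> V" "v \<in> V" "lev u = lev v" "q \<le> lev u" "anc q u \<inter> anc q v = {}"
    and xy: "x \<in> anc q u" "y \<in> anc q v" "E x y" "ord x < ord y"
  shows "least_anc q u \<in> wreach2 (least_anc q v) \<or> least_anc q v \<in> wreach2 (least_anc q u)"
proof -
  let ?a = "least_anc q u" and ?b = "least_anc q v"
  have a: "?a \<in> anc q u" and b: "?b \<in> anc q v"
    using least_anc(1)[of u q] least_anc(1)[of v q] uv by auto
  have l: "lev ?a = lev ?b" "lev x = lev ?b" "lev ?a = lev x"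
    using anc_lev[OF a] anc_lev[OF b] anc_lev[OF xy(1)] uv(3) by simp_all
  have ab: "?a \<noteq> ?b" "?b \<noteq> x" using a b xy uv(5) by auto
  have V: "?b \<in> V" "x \<in> V" using a b xy anc_in_V uv by blast+
  have Eb: "E x ?b"
    using least_anc_cases[of v q y] ord_elim[of x y ?b] uv xy ab by auto
  have Ea: "?a = x \<or> E ?a x \<and> ord ?a < ord x"
    using least_anc_cases[of u q x] uv xy by auto
  show ?thesis
  proof (cases "ord x < ord ?b")
    case True
    then have "x \<in> lower ?b" using Eb l by (simp add: lower_def)
    moreover have "?a \<in> insert x (lower x)" using Ea l by (auto simp: lower_def)
    ultimately show ?thesis unfolding wreach2_def by blast
  next
    case False
    then have "ord ?b < ord x" using ab V inj_onD[OF inj_ord, of ?b x] by (auto simp: le_less not_less)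
    then have "E ?a ?b" using Ea Eb ord_elim[of ?a x ?b] ab E_sym[OF Eb] by auto
    then show ?thesis using adjacent_wreach2 l by blast
  qed
qed

text \<open>If the ancestor sets share a vertex \<open>z\<close>, each least ancestor is
  \<open>z\<close> or an earlier neighbour of \<open>z\<close>, so the two are equal or adjacent.
  Disjoint sets are covered by \<open>least_anc_wreach2\<close>, up to exchanging \<open>u\<close>
  and \<open>v\<close>.\<close>

lemma least_anc_eq_or_wreach2:
  assumes uv: "u \<in> V" "v \<in> V" "lev u = lev v" "q \<le> lev u"
    and xy: "x \<in> anc q u" "y \<in> anc q v" "x = y \<or> E x y"
  shows "least_anc q u = least_anc q v \<or>
    least_anc q u \<in> wreach2 (least_anc q v) \<or> least_anc q v \<in> wreach2 (least_anc q u)"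
proof (cases "anc q u \<inter> anc q v = {}")
  case True
  then have E: "E x y" using xy by auto
  then have "ord x \<noteq> ord y" using inj_onD[OF inj_ord, of x y] E_in_V[OF E] E_irrefl by auto
  then consider "ord x < ord y" | "ord y < ord x" by linarith
  then show ?thesis
  proof cases
    case 1
    then show ?thesis using least_anc_wreach2[OF uv True xy(1,2) E] by blast
  next
    case 2
    moreover have "E y x" "q \<le> lev v" "anc q v \<inter> anc q u = {}" using E E_sym uv True by auto
    ultimately show ?thesis using least_anc_wreach2[OF uv(2,1) uv(3)[symmetric] _ _ xy(2,1)] by blast
  qed
next
  case False
  let ?a = "least_anc q u" and ?b = "least_anc q v"
  obtain z where z: "z \<in> anc q u" "z \<in> anc q v" using False by blast
  have a: "?a \<in> anc q u" and b: "?b \<in> anc q v"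
    using least_anc(1)[of u q] least_anc(1)[of v q] uv by auto
  have "?a = z \<or> E ?a z \<and> ord ?a < ord z" "?b = z \<or> E ?b z \<and> ord ?b < ord z"
    using least_anc_cases[of u q z] least_anc_cases[of v q z] uv z by auto
  then have "?a = ?b \<or> E ?a ?b" using ord_elim[of ?a z ?b] E_sym by metis
  moreover have "lev ?a = lev ?b" using anc_lev[OF a] anc_lev[OF b] uv(3) by simp
  ultimately show ?thesis using adjacent_wreach2 by blast
qed

text \<open>A common least ancestor would give a walk of length \<open>2 * q\<close>. The ancestors
  are joined across the middle edge of the given walk.\<close>

lemma odd_distance_wreach2:
  assumes uv: "u \<in> V" "v \<in> V" "lev u = lev v" "q \<le> lev u"
    and dist: "(E ^^ (2 * q + 1)) u v" "\<not> (E ^^ (2 * q)) u v"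
  shows "least_anc q u \<in> wreach2 (least_anc q v) \<or> least_anc q v \<in> wreach2 (least_anc q u)"
proof -
  have "least_anc q u \<noteq> least_anc q v"
  proof
    assume "least_anc q u = least_anc q v"
    then have "(E ^^ q) (least_anc q u) u" "(E ^^ q) (least_anc q u) v"
      using least_anc(1)[of u q] least_anc(1)[of v q] uv by (auto simp: anc_def)
    then have "(E ^^ (q + q)) u v" using relpowp_trans relpowp_sym by metis
    with dist(2) show False by (simp add: mult_2)
  qed
  moreover have "(E ^^ (q + Suc q)) u v" using dist(1) by (simp add: mult_2)
  then obtain w where w: "(E ^^ q) u w" "(E ^^ Suc q) w v" unfolding relpowp_add by blast
  then obtain w' where w': "E w w'" "(E ^^ q) w' v" by (meson relpowp_Suc_E2)
  obtain x y where "x \<in> anc q u" "y \<in> anc q v" "x = y \<or> E x y"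
    using anc_join[OF w(1) relpowp_sym[OF w'(2)]] w'(1) uv by blast
  from least_anc_eq_or_wreach2[OF uv this]
  have "least_anc q u = least_anc q v \<or>
    least_anc q u \<in> wreach2 (least_anc q v) \<or> least_anc q v \<in> wreach2 (least_anc q u)" .
  ultimately show ?thesis by blast
qed

lemma even_distance_wreach2:
  assumes uv: "u \<in> V" "v \<in> V" "lev u = lev v" "q \<le> lev u"
    and dist: "(E ^^ (2 * q)) u v"
  shows "least_anc q u = least_anc q v \<or>
    least_anc q u \<in> wreach2 (least_anc q v) \<or> least_anc q v \<in> wreach2 (least_anc q u)"
proof -
  have "(E ^^ (q + q)) u v" using dist by (simp add: mult_2)
  then obtain w where w: "(E ^^ q) u w" "(E ^^ q) w v" unfolding relpowp_add by blast
  obtain x y where "x \<in> anc q u" "y \<in> anc q v" "x = y \<or> E x y"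
    using anc_join[OF w(1) relpowp_sym[OF w(2)]] uv by blast
  then show ?thesis by (rule least_anc_eq_or_wreach2[OF uv])
qed

end

section \<open>Colouring exact distances\<close>

lemma mixed_radix_less:
  fixes a b k n :: nat
  assumes "a < k" "b < n"
  shows "a + k * b < n * k"
proof -
  have "a + k * b < k * Suc b" using assms(1) by simp
  also have "\<dots> \<le> k * n" using assms(2) by (intro mult_le_mono2) simp
  finally show ?thesis by (simp add: mult.commute)
qed

lemma mixed_radix_eq:
  fixes a a' b b' k :: nat
  assumes "a + k * b = a' + k * b'" "a < k" "a' < k"
  shows "a = a'" "b = b'"
proof -
  have "(a + k * b) mod k = (a' + k * b') mod k" "(a + k * b) div k = (a' + k * b') div k"
    using assms(1) by simp_all
  then show "a = a'" "b = b'" using assms(2,3) by simp_all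
qed

lemma mod_eq_imp_eq:
  fixes a b p :: nat
  assumes "a mod Suc p = b mod Suc p" "a \<le> b + p" "b \<le> a + p"
  shows "a = b"
proof -
  have "x = y" if "x mod Suc p = y mod Suc p" "y \<le> x" "x \<le> y + p" for x y :: nat
  proof -
    have "Suc p dvd x - y" using that(1,2) by (simp add: mod_eq_dvd_iff_nat)
    moreover have "x - y < Suc p" using that(3) by simp
    ultimately have "\<not> 0 < x - y" using nat_dvd_not_less by blast
    then show ?thesis using that(2) by simp
  qed
  then show ?thesis using assms by (metis nle_le)
qed

lemma symp_rtranclp_representative:
  assumes "symp R" "R\<^sup>*\<^sup>* x y"
  shows "(SOME w. R\<^sup>*\<^sup>* x w) = (SOME w. R\<^sup>*\<^sup>* y w)"
proof -
  have "R\<^sup>*\<^sup>* y x" using assms by (simp add: sympD symp_rtranclp)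
  then have "R\<^sup>*\<^sup>* x w \<longleftrightarrow> R\<^sup>*\<^sup>* y w" for w
    using assms(2) by (meson rtranclp_trans)
  then show ?thesis by simp
qed

text \<open>The level is the distance from a root chosen once per component; symmetry of
  \<open>R\<close> makes the choice depend on the component only.\<close>

lemma ex_level_function:
  fixes R :: "'a \<Rightarrow> 'a \<Rightarrow> bool"
  assumes "symp R"
  shows "\<exists>lev :: 'a \<Rightarrow> nat. (\<forall>x y. R x y \<longrightarrow> lev y \<le> Suc (lev x)) \<and>
    (\<forall>x n. lev x = Suc n \<longrightarrow> (\<exists>w. R w x \<and> lev w = n)) \<and>
    (\<forall>x y. lev x = 0 \<longrightarrow> lev y = 0 \<longrightarrow> R\<^sup>*\<^sup>* x y \<longrightarrow> x = y)"
proof -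
  define root where "root x = (SOME w. R\<^sup>*\<^sup>* x w)" for x
  define lev where "lev x = (LEAST n. (R ^^ n) (root x) x)" for x
  have root_eq: "root x = root y" if "R\<^sup>*\<^sup>* x y" for x y
    unfolding root_def by (rule symp_rtranclp_representative[OF assms that])
  have "R\<^sup>*\<^sup>* x (root x)" for x unfolding root_def by (rule someI[of _ x]) simp
  then have "R\<^sup>*\<^sup>* (root x) x" for x using assms by (simp add: sympD symp_rtranclp)
  then have "\<exists>n. (R ^^ n) (root x) x" for x by (rule rtranclp_imp_relpowp)
  then have lev: "(R ^^ lev x) (root x) x" for x unfolding lev_def by (rule LeastI_ex)
  have le: "lev x \<le> n" if "(R ^^ n) (root x) x" for x n
    unfolding lev_def using that by (rule Least_le)
  have edge: "lev y \<le> Suc (lev x)" if "R x y" for x y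
  proof (rule le)
    have "(R ^^ Suc (lev x)) (root x) y" using lev that by (rule relpowp_Suc_I)
    moreover have "root x = root y" using that by (intro root_eq) simp
    ultimately show "(R ^^ Suc (lev x)) (root y) y" by simp
  qed
  show ?thesis
  proof (intro exI[of _ lev] conjI allI impI)
    fix x y assume "R x y"
    then show "lev y \<le> Suc (lev x)" by (rule edge)
  next
    fix x n assume n: "lev x = Suc n"
    obtain w where w: "(R ^^ n) (root x) w" "R w x"
      using lev[of x] unfolding n by (rule relpowp_Suc_E)
    have "lev w \<le> n" using le[of n w] w(1) root_eq[OF r_into_rtranclp[of R, OF w(2)]] by simp
    moreover have "n \<le> lev w" using edge[OF w(2)] n by simp
    ultimately show "\<exists>w. R w x \<and> lev w = n" using w(2) by auto
  next
    fix x y assume "lev x = 0" "lev y = 0" "R\<^sup>*\<^sup>* x y"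
    then show "x = y" using lev[of x] lev[of y] root_eq[of x y] by simp
  qed
qed

section \<open>The colourings for odd and even distances\<close>

context layered_chordal_graph
begin

lemma exact_distance_lev_eq:
  assumes "(E ^^ p) u v" "lev u mod Suc p = lev v mod Suc p"
  shows "lev u = lev v"
  using mod_eq_imp_eq[OF assms(2) lev_relpowp[OF relpowp_sym[OF assms(1)]] lev_relpowp[OF assms(1)]] .

lemma exact_distance_lev_ge:
  assumes "(E ^^ p) u v" "\<And>m. m < p \<Longrightarrow> \<not> (E ^^ m) u v" "lev u = lev v"
  shows "p \<le> 2 * lev u"
  using same_layer_dist[OF assms(1) refl] assms(2,3) by (metis not_le)

lemma odd_distance_coloring:
  assumes "odd p"
  shows "\<exists>c. (\<forall>v. c v < (t choose 2) * (p + 1)) \<and>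
    (\<forall>u\<in>V. \<forall>v\<in>V. (E ^^ p) u v \<longrightarrow> (\<forall>m<p. \<not> (E ^^ m) u v) \<longrightarrow> c u \<noteq> c v)"
proof -
  obtain q where p: "p = 2 * q + 1" using assms oddE by blast
  obtain f where f: "\<And>x. f x < t choose 2" "\<And>x y. y \<in> V \<Longrightarrow> x \<in> wreach2 y \<Longrightarrow> f x \<noteq> f y"
    using wreach2_coloring by blast
  \<comment> \<open>For \<open>lev v < q\<close> the set \<open>anc q v\<close> is empty and
    \<open>least_anc q v\<close> is arbitrary. This is harmless, because two vertices of one layer
    \<open>j\<close> at distance \<open>p\<close> satisfy \<open>p \<le> 2 * j\<close>, hence
    \<open>q \<le> j\<close>.\<close>
  define c where "c v = lev v mod Suc p + Suc p * f (least_anc q v)" for v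
  have "c v < (t choose 2) * (p + 1)" for v
    unfolding c_def using mixed_radix_less[of "lev v mod Suc p" "Suc p", OF _ f(1)] by simp
  moreover have "c u \<noteq> c v"
    if uv: "u \<in> V" "v \<in> V" "(E ^^ p) u v" "\<And>m. m < p \<Longrightarrow> \<not> (E ^^ m) u v" for u v
  proof
    assume "c u = c v"
    from mixed_radix_eq[OF this[unfolded c_def]]
    have c: "lev u mod Suc p = lev v mod Suc p" "f (least_anc q u) = f (least_anc q v)" by simp_all
    have l: "lev u = lev v" using uv(3) c(1) by (rule exact_distance_lev_eq)
    then have q: "q \<le> lev u" using exact_distance_lev_ge[OF uv(3,4)] p by simp
    have "least_anc q u \<in> wreach2 (least_anc q v) \<or> least_anc q v \<in> wreach2 (least_anc q u)"
      using odd_distance_wreach2[OF uv(1,2) l q] uv(3) uv(4)[of "2 * q"] p by simp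
    moreover have "least_anc q u \<in> V" "least_anc q v \<in> V"
      using least_anc(1) anc_in_V uv(1,2) q l by (metis subsetD)+
    ultimately show False using f(2) c(2) by metis
  qed
  ultimately show ?thesis by blast
qed

lemma even_distance_coloring:
  assumes "even p" "p > 0" "D > 0" "\<And>x. card {y. E x y} \<le> D"
  shows "\<exists>c. (\<forall>v. c v < (t choose 2) * D * (p + 1)) \<and>
    (\<forall>u\<in>V. \<forall>v\<in>V. (E ^^ p) u v \<longrightarrow> (\<forall>m<p. \<not> (E ^^ m) u v) \<longrightarrow> c u \<noteq> c v)"
proof -
  obtain r where p: "p = 2 * Suc r" using assms(1,2) by (metis evenE mult_0_right not_gr0 not0_implies_Suc)
  define q where "q = Suc r"
  obtain f where f: "\<And>x. f x < t choose 2" "\<And>x y. y \<in> V \<Longrightarrow> x \<in> wreach2 y \<Longrightarrow> f x \<noteq> f y"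
    using wreach2_coloring by blast
  have "\<exists>h. (\<forall>y. h y < D) \<and> inj_on h {y. E x y}" for x
  proof -
    have "finite {y. E x y}" using E_in_V by (intro finite_subset[OF _ finite_V]) blast
    then obtain h where h: "inj_on h {y. E x y}" "h ` {y. E x y} = {..<card {y. E x y}}"
      using ex_bij_betw_finite_nat[of "{y. E x y}"] by (auto simp: bij_betw_def atLeast0LessThan)
    \<comment> \<open>The default 0 lies below \<open>D\<close> because \<open>D > 0\<close>, so the
      bound holds also off the neighbours of \<open>x\<close>.\<close>
    define h' where "h' y = (if E x y then h y else 0)" for y
    have "h y < D" if "E x y" for y
      using h(2) that assms(4)[of x] by (metis imageI lessThan_iff less_le_trans mem_Collect_eq)
    then have "h' y < D" for y using assms(3) by (simp add: h'_def)
    moreover have "inj_on h' {y. E x y}" using h(1) by (simp add: inj_on_def h'_def)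
    ultimately show ?thesis by blast
  qed
  then obtain h where h: "\<And>x y. h x y < D" "\<And>x. inj_on (h x) {y. E x y}" by metis
  \<comment> \<open>The second vertex of a walk of length \<open>q = Suc r\<close> from the least
    ancestor to \<open>v\<close>; its number among the neighbours of that ancestor enters the
    colour.\<close>
  define s where "s v = (SOME w. E (least_anc q v) w \<and> (E ^^ r) w v)" for v
  have s: "E (least_anc q v) (s v)" "(E ^^ r) (s v) v" if "v \<in> V" "q \<le> lev v" for v
  proof -
    have "(E ^^ Suc r) (least_anc q v) v" using least_anc(1)[OF that] by (simp add: anc_def q_def)
    then have "\<exists>w. E (least_anc q v) w \<and> (E ^^ r) w v" by (rule relpowp_Suc_D2)
    then have "E (least_anc q v) (s v) \<and> (E ^^ r) (s v) v" unfolding s_def by (rule someI_ex)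
    then show "E (least_anc q v) (s v)" "(E ^^ r) (s v) v" by simp_all
  qed
  define g where "g v = f (least_anc q v) + (t choose 2) * h (least_anc q v) (s v)" for v
  have g: "g v < (t choose 2) * D" for v
    unfolding g_def mult.commute[of "t choose 2" D] by (rule mixed_radix_less[OF f(1) h(1)])
  define c where "c v = lev v mod Suc p + Suc p * g v" for v
  have "c v < (t choose 2) * D * (p + 1)" for v
    unfolding c_def using mixed_radix_less[of "lev v mod Suc p" "Suc p", OF _ g] by simp
  moreover have "c u \<noteq> c v"
    if uv: "u \<in> V" "v \<in> V" "(E ^^ p) u v" "\<And>m. m < p \<Longrightarrow> \<not> (E ^^ m) u v" for u v
  proof
    assume "c u = c v"
    from mixed_radix_eq[OF this[unfolded c_def]]
    have c: "lev u mod Suc p = lev v mod Suc p" "g u = g v" by simp_all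
    from mixed_radix_eq[OF c(2)[unfolded g_def] f(1) f(1)]
    have fh: "f (least_anc q u) = f (least_anc q v)"
      "h (least_anc q u) (s u) = h (least_anc q v) (s v)" by simp_all
    have l: "lev u = lev v" using uv(3) c(1) by (rule exact_distance_lev_eq)
    then have q: "q \<le> lev u" using exact_distance_lev_ge[OF uv(3,4)] p by (simp add: q_def)
    have "least_anc q u \<in> V" "least_anc q v \<in> V"
      using least_anc(1) anc_in_V uv(1,2) q l by (metis subsetD)+
    then have eq: "least_anc q u = least_anc q v"
      using even_distance_wreach2[OF uv(1,2) l q] uv(3) p f(2) fh(1) by (metis q_def)
    have su: "E (least_anc q u) (s u)" "(E ^^ r) (s u) u" using s uv(1) q by blast+
    have sv: "E (least_anc q u) (s v)" "(E ^^ r) (s v) v" using s[of v] uv(2) q l eq by simp_all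
    have "s u = s v" using h(2)[of "least_anc q u"] su(1) sv(1) fh(2) eq by (auto dest: inj_onD)
    \<comment> \<open>Going through the shared neighbour takes \<open>2 * r = p - 2\<close>
      steps.\<close>
    then have "(E ^^ (r + r)) u v" using relpowp_trans[OF relpowp_sym[OF su(2)]] sv(2) by simp
    with uv(4)[of "r + r"] p show False by simp
  qed
  ultimately show ?thesis by blast
qed

end

section \<open>Transfer to pair graphs\<close>

text \<open>The start of an \<open>awalk\<close> must be a vertex, whereas the zeroth power relates
  every element to itself; hence the extra conjunct.\<close>

lemma (in pair_graph) awalk_iff_relpowp:
  "(\<exists>c. awalk u c v \<and> length c = n) \<longleftrightarrow> u \<in> pverts G \<and> ((\<lambda>x y. (x, y) \<in> parcs G) ^^ n) u v"
proof (induction n arbitrary: u)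
  case 0
  then show ?case by (auto simp: awalk_Nil_iff)
next
  case (Suc n)
  have "(\<exists>c. awalk u c v \<and> length c = Suc n) \<longleftrightarrow>
    (\<exists>w. (u, w) \<in> parcs G \<and> (\<exists>c. awalk w c v \<and> length c = n))"
  proof
    assume "\<exists>c. awalk u c v \<and> length c = Suc n"
    then obtain e c where "awalk u (e # c) v" "length c = n" by (auto simp: length_Suc_conv)
    then show "\<exists>w. (u, w) \<in> parcs G \<and> (\<exists>c. awalk w c v \<and> length c = n)"
      by (cases e) (auto simp: awalk_Cons_iff)
  next
    assume "\<exists>w. (u, w) \<in> parcs G \<and> (\<exists>c. awalk w c v \<and> length c = n)"
    then obtain w c where "(u, w) \<in> parcs G" "awalk w c v" "length c = n" by blast
    then show "\<exists>c. awalk u c v \<and> length c = Suc n"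
      by (intro exI[of _ "(u, w) # c"]) (auto simp: awalk_Cons_iff)
  qed
  then show ?case
    unfolding Suc.IH relpowp_Suc_left by (auto dest: in_arcsD1 in_arcsD2)
qed

lemma exact_distance_graph_arc_iff:
  assumes "pair_graph G"
  shows "(u, v) \<in> parcs (exact_distance_graph G p) \<longleftrightarrow> u \<in> pverts G \<and> v \<in> pverts G \<and>
    ((\<lambda>x y. (x, y) \<in> parcs G) ^^ p) u v \<and> (\<forall>m<p. \<not> ((\<lambda>x y. (x, y) \<in> parcs G) ^^ m) u v)"
proof -
  interpret pair_graph G by (fact assms)
  have "(\<forall>c. awalk u c v \<longrightarrow> p \<le> length c) \<longleftrightarrow> (\<forall>m<p. \<not> (\<exists>c. awalk u c v \<and> length c = m))"
    by (metis not_le)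
  then show ?thesis
    unfolding exact_distance_graph_def
    by (auto simp: graph_dist_eq_iff[OF assms] awalk_iff_relpowp)
qed

lemma (in pair_graph) awalk_zip_tl:
  assumes "successively (\<lambda>x y. (x, y) \<in> parcs G) (x # xs)" "x \<in> pverts G"
  shows "awalk x (zip (x # xs) xs) (last (x # xs)) \<and> awalk_verts x (zip (x # xs) xs) = x # xs"
  using assms
proof (induction xs arbitrary: x)
  case Nil
  then show ?case by (simp add: awalk_Nil_iff)
next
  case (Cons y ys)
  then have "y \<in> pverts G" by (auto dest: in_arcsD2)
  with Cons show ?case by (auto simp: awalk_Cons_iff)
qed

text \<open>A cyclic list of vertices is turned into a closed walk of arcs. A chord from
  \<open>chordal\<close> joins two positions whose pair is not an arc of this walk in either
  direction, so they are not cyclically consecutive.\<close>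

lemma pair_graph_chordal_graph:
  assumes "pair_graph G" "chordal G"
  shows "chordal_graph (pverts G) (\<lambda>x y. (x, y) \<in> parcs G)"
proof -
  interpret pair_graph G by (fact assms(1))
  have sym: "(y, x) \<in> parcs G" if "(x, y) \<in> parcs G" for x y
    using that pair_sym_arcs by (auto simp: symmetric_def dest: symD)
  show ?thesis
  proof
    show "finite (pverts G)" by (rule pair_finite_verts)
    show "x \<in> pverts G \<and> y \<in> pverts G" if "(x, y) \<in> parcs G" for x y
      using that by (auto dest: in_arcsD1 in_arcsD2)
    show "(y, x) \<in> parcs G" if "(x, y) \<in> parcs G" for x y using that by (rule sym)
    show "(x, x) \<notin> parcs G" for x using pair_no_loops by fastforce
    fix c assume c: "distinct c" "length c \<ge> 4" "successively (\<lambda>x y. (x, y) \<in> parcs G) c"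
      "(last c, hd c) \<in> parcs G"
    then obtain x xs where cx: "c = x # xs" by (cases c) auto
    \<comment> \<open>Repeating \<open>x\<close> at the end supplies the closing arc.\<close>
    define a where "a = zip (x # xs @ [x]) (xs @ [x])"
    have la: "length a = length c" by (simp add: a_def cx)
    have nth: "a ! i = (c ! i, if Suc i = length c then c ! 0 else c ! Suc i)" if "i < length c" for i
      using that by (auto simp: a_def cx nth_append nth_Cons' less_Suc_eq)
    have "successively (\<lambda>x y. (x, y) \<in> parcs G) (x # xs @ [x])"
      using c(3,4) successively_append_iff[of "\<lambda>x y. (x, y) \<in> parcs G" "x # xs" "[x]"]
      by (simp add: cx)
    moreover have "x \<in> pverts G" using c(4) cx by (auto dest: in_arcsD2)
    ultimately have "awalk x a x" "awalk_verts x a = x # xs @ [x]"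
      using awalk_zip_tl[of x "xs @ [x]"] by (simp_all add: a_def)
    moreover have "distinct (xs @ [x])" using c(1) cx by simp
    ultimately have "cycle a" using la c(2) by (auto simp: cycle_def)
    then obtain u v where uv: "chord_of G a u v"
      using assms(2) la c(2) unfolding chordal_def by fastforce
    have "fst ` set a \<subseteq> set c"
      by (auto simp: a_def cx dest!: set_zip_leftD)
    then obtain i k where ik: "i < length c" "k < length c" "u = c ! i" "v = c ! k"
      using uv unfolding chord_of_def by (metis in_set_conv_nth subsetD)
    have ne: "i \<noteq> k" using uv ik pair_no_loops unfolding chord_of_def by fastforce
    have notin: "(c ! i, c ! k) \<notin> set a" "(c ! k, c ! i) \<notin> set a" "(c ! i, c ! k) \<in> parcs G"
      using uv ik unfolding chord_of_def by auto
    have chord: "Suc i' < k' \<and> \<not> (i' = 0 \<and> Suc k' = length c)"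
      if "i' < k'" "k' < length c" "(c ! i', c ! k') \<notin> set a" "(c ! k', c ! i') \<notin> set a" for i' k'
    proof -
      have "Suc i' \<noteq> k'"
        using nth[of i'] nth_mem[of i' a] la that by auto
      moreover have "\<not> (i' = 0 \<and> Suc k' = length c)"
        using nth[of k'] nth_mem[of k' a] la that by auto
      ultimately show ?thesis using that by simp
    qed
    show "\<exists>i k. Suc i < k \<and> k < length c \<and> \<not> (i = 0 \<and> Suc k = length c) \<and> (c ! i, c ! k) \<in> parcs G"
    proof (cases "i < k")
      case True
      then show ?thesis using chord[of i k] notin ik by blast
    next
      case False
      then show ?thesis using chord[of k i] notin ik ne sym by (metis nat_neq_iff)
    qed
  qed
qed

lemma (in chordal_graph) ex_layered:
  assumes "\<And>K. K \<subseteq> V \<Longrightarrow> (\<And>x y. x \<in> K \<Longrightarrow> y \<in> K \<Longrightarrow> x \<noteq> y \<Longrightarrow> E x y) \<Longrightarrow> card K \<le> t" "t \<ge> 2"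
  shows "\<exists>lev ord. layered_chordal_graph V E lev ord t"
proof -
  have "symp E" by (auto simp: symp_def intro: E_sym)
  from ex_level_function[OF this] obtain lev :: "'a \<Rightarrow> nat" where lev:
    "\<And>x y. E x y \<Longrightarrow> lev y \<le> Suc (lev x)" "\<And>x n. lev x = Suc n \<Longrightarrow> \<exists>w. E w x \<and> lev w = n"
    "\<And>x y. lev x = 0 \<Longrightarrow> lev y = 0 \<Longrightarrow> E\<^sup>*\<^sup>* x y \<Longrightarrow> x = y" by blast
  obtain ord :: "'a \<Rightarrow> nat" where ord: "inj_on ord V"
    "\<forall>s\<in>V. \<forall>x\<in>V. \<forall>y\<in>V. E x s \<longrightarrow> E y s \<longrightarrow> ord x < ord s \<longrightarrow> ord y < ord s \<longrightarrow> x \<noteq> y \<longrightarrow> E x y"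
    using perfect_elimination_order[OF finite_V] by blast
  have "layered_chordal_graph V E lev ord t"
  proof
    show "E x y" if "E x s" "E y s" "ord x < ord s" "ord y < ord s" "x \<noteq> y" for x y s
      using ord(2)[rule_format, of s x y] that E_in_V[OF that(1)] E_in_V[OF that(2)] by blast
  qed (fact lev ord(1) assms)+
  then show ?thesis by blast
qed

lemma chromatic_number_exact_distance_le:
  assumes "pair_graph G" "\<And>v. c v < k"
    "\<forall>u\<in>pverts G. \<forall>v\<in>pverts G. ((\<lambda>x y. (x, y) \<in> parcs G) ^^ p) u v \<longrightarrow>
      (\<forall>m<p. \<not> ((\<lambda>x y. (x, y) \<in> parcs G) ^^ m) u v) \<longrightarrow> c u \<noteq> c v"
  shows "chromatic_number (exact_distance_graph G p) \<le> k"
  unfolding chromatic_number_def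
proof (intro Least_le exI[of _ c] conjI)
  show "c ` pverts (exact_distance_graph G p) \<subseteq> {..<k}" using assms(2) by auto
  show "proper_coloring (exact_distance_graph G p) c"
    unfolding proper_coloring_def using assms(3) by (auto simp: exact_distance_graph_arc_iff[OF assms(1)])
qed

lemma card_neighbors_le_max_degree:
  assumes "pair_graph G"
  shows "card {y. (x, y) \<in> parcs G} \<le> max_degree G"
proof -
  interpret pair_graph G by (fact assms)
  show ?thesis
  proof (cases "x \<in> pverts G")
    case True
    have "out_arcs (with_proj G) x = Pair x ` {y. (x, y) \<in> parcs G}" by (auto simp: out_arcs_def)
    then have "out_degree (with_proj G) x = card {y. (x, y) \<in> parcs G}"
      by (simp add: out_degree_def card_image inj_on_def)
    moreover have "out_degree (with_proj G) x \<le> max_degree G"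
      unfolding max_degree_def using True pair_finite_verts by (intro Max_ge) auto
    ultimately show ?thesis by simp
  next
    case False
    then have "{y. (x, y) \<in> parcs G} = {}" by (auto dest: in_arcsD1)
    then show ?thesis by simp
  qed
qed

theorem theorem1p4:
  fixes G :: "'a pair_pre_digraph" and t :: nat
  assumes "pair_graph G"
    and "chordal G"
    and "clique_number G = t"
    and "t \<ge> 2"
  shows "(\<forall>p::nat. p \<ge> 1 \<and> odd p \<longrightarrow>
            chromatic_number (exact_distance_graph G p) \<le> (t choose 2) * (p + 1)) \<and>
         (\<forall>p::nat. p \<ge> 2 \<and> even p \<longrightarrow>
            chromatic_number (exact_distance_graph G p) \<le> (t choose 2) * max_degree G * (p + 1))"
proof -
  interpret pair_graph G by (fact assms(1))
  interpret C: chordal_graph "pverts G" "\<lambda>x y. (x, y) \<in> parcs G"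
    by (rule pair_graph_chordal_graph[OF assms(1,2)])
  have "card K \<le> t" if "K \<subseteq> pverts G" "\<And>x y. x \<in> K \<Longrightarrow> y \<in> K \<Longrightarrow> x \<noteq> y \<Longrightarrow> (x, y) \<in> parcs G" for K
    using clique_number_clique(2)[OF assms(1), of K] assms(3) that by (auto simp: is_clique_def)
  then obtain lev ord where "layered_chordal_graph (pverts G) (\<lambda>x y. (x, y) \<in> parcs G) lev ord t"
    using C.ex_layered assms(4) by blast
  then interpret L: layered_chordal_graph "pverts G" "\<lambda>x y. (x, y) \<in> parcs G" lev ord t .
  have deg: "card {y. (x, y) \<in> parcs G} \<le> max_degree G" for x
    using assms(1) by (rule card_neighbors_le_max_degree)
  \<comment> \<open>A clique with at least two vertices contains an edge.\<close>
  have pos: "max_degree G > 0"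
  proof -
    obtain K where K: "is_clique G K" "card K = t" using clique_number_clique(1)[OF assms(1)] assms(3) by blast
    then have "finite K" "\<not> card K \<le> Suc 0" using assms(4) by (auto intro: card_ge_0_finite)
    then obtain x y where "x \<in> K" "y \<in> K" "x \<noteq> y" using card_le_Suc0_iff_eq by blast
    then have "(x, y) \<in> parcs G" using K(1) by (simp add: is_clique_def)
    moreover have "finite {y. (x, y) \<in> parcs G}"
      by (rule finite_subset[OF _ pair_finite_verts]) (auto dest: in_arcsD2)
    ultimately have "card {y. (x, y) \<in> parcs G} > 0" by (auto simp: card_gt_0_iff)
    then show ?thesis using deg[of x] by simp
  qed
  show ?thesis
  proof (intro conjI allI impI)
    fix p :: nat assume "p \<ge> 1 \<and> odd p"
    then show "chromatic_number (exact_distance_graph G p) \<le> (t choose 2) * (p + 1)"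
      using L.odd_distance_coloring[of p] chromatic_number_exact_distance_le[OF assms(1)] by blast
  next
    fix p :: nat assume "p \<ge> 2 \<and> even p"
    then have "even p" "p > 0" by auto
    from L.even_distance_coloring[OF this pos deg]
    show "chromatic_number (exact_distance_graph G p) \<le> (t choose 2) * max_degree G * (p + 1)"
      using chromatic_number_exact_distance_le[OF assms(1)] by (elim exE conjE) blast
  qed
qed

end
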